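(* Let $T>0$ and let $Y(t)=\sum_{i=1}^{N(t)}X_i\,h_i(t,T_i)$, $t\ge0$, be a shot noise process as described in the context, where $\{N(t)\}$ is an inhomogeneous Poisson process with intensity function $\lambda(\cdot)$, cumulative intensity function $m(\cdot)$ and points $T_1\le T_2\le\cdots$. For $t\in(0,T]$ let $V_0^{(t)}$ denote a random variable, independent of $h_0$, with density $\lambda(s)/m(t)$, $0\le s\le t$. Assume that, for some $\alpha>0$: (i) the nonnegative random variables $X_i$ are identically distributed with common mean $\gamma$, and $x\mapsto\overline F_X(x)=\mathbb{P}(X_1>x)$ is regularly varying at infinity with index $-\alpha$; (ii) $\displaystyle\sup_{i\neq j}\frac{\mathbb{P}(X_i>x,X_j>x)}{\mathbb{P}(X_1>x)}\to0$ as $x\to\infty$; (iii) the random functions $h_j(T,\cdot)$ are i.i.d., independent of the $T_j$'s, and integrable of order $p$ for some $p>\alpha$. Then the integrated expected severity $IES(x)=\int_0^T\mathbb{E}\big[[Y(t)-x]_+\big]\,dt$ satisfies $$IES(x)\underset{x\to\infty}{\sim}\gamma\int_0^T\mathbb{E}[N(t)]\;\mathbb{E}\big[h_0^{\alpha}(t,V_0^{(t)})\big]\,dt\;\;\overline{F_X^{I}}(x).$$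
   Context: The shocks $(X_i)_{i\ge1}$ are nonnegative random variables (not necessarily independent of each other); the shock functions $(h_i)$ are i.i.d. nonnegative measurable random functions $(t,s)\mapsto h_i(t,s)$, $h_0$ denoting a generic copy; the shock instants $(T_i)_{i\ge1}$ are the points of the Poisson process and $N(t)=\#\{i:T_i\le t\}$. The sequence $(X_i)$ is independent of the $(h_i)$ and of the $(T_i)$. It is assumed throughout that for all $i$ and all $t>0$ there exists $\epsilon>0$ such that $\mathbb{E}[h_i^{\alpha+\epsilon}(t,T_i)]<\infty$. Here $m(t)=\int_0^t\lambda(s)\,ds=\mathbb{E}[N(t)]$. "Integrable of order $p$" means finiteness of the $p$-th moment, $\mathbb{E}[h_0^{p}(T,V_0^{(T)})]<\infty$. $[\cdot]_+$ is the positive part, $h_0^\alpha(t,s)$ means $(h_0(t,s))^\alpha$, and the integrated tail is $\overline{F_X^I}(y)=\frac1\gamma\int_y^\infty\overline F_X(x)\,dx$, $y>0$. $f(x)\sim g(x)$ means $f(x)/g(x)\to1$ as $x\to\infty$.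
   Formalization: Added: the p-th moment condition is required over the horizon, ∫_0^T E[N(t)] E[h_0^p(t,V_0^(t))] dt < ∞, not only at time T (the claim fails otherwise); independence of the h_j from the T_j is taken for the whole functions h_j(t,s), not just h_j(T,·). *)

theory Defs
  imports "HOL-Probability.Probability" "HOL-Library.Landau_Symbols"
begin

(* The library's indep_var requires both random variables to have the same value type;
   this is the same notion for random elements of two arbitrary measurable spaces. *)
definition indep_elements ::
  "'a measure \<Rightarrow> 'b measure \<Rightarrow> ('a \<Rightarrow> 'b) \<Rightarrow> 'c measure \<Rightarrow> ('a \<Rightarrow> 'c) \<Rightarrow> bool" where
  "indep_elements M A X B Y \<longleftrightarrow>
     X \<in> measurable M A \<and> Y \<in> measurable M B \<and>
     prob_space.indep_set M {X -` U \<inter> space M |U. U \<in> sets A} {Y -` U \<inter> space M |U. U \<in> sets B}"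

lemma (in prob_space) indep_elements_iff_indep_var:
  "indep_elements M A X B Y \<longleftrightarrow> indep_var A X B Y"
proof -
  have "(\<lambda>i. {case_bool X Y i -` U \<inter> space M |U. U \<in> sets (case_bool A B i)}) =
      case_bool {X -` U \<inter> space M |U. U \<in> sets A} {Y -` U \<inter> space M |U. U \<in> sets B}"
    by (rule ext) (simp split: bool.split)
  then show ?thesis
    unfolding indep_elements_def indep_var_def indep_vars_def2 indep_set_def
    by (auto simp: UNIV_bool)
qed

definition regularly_varying :: "(real \<Rightarrow> real) \<Rightarrow> real \<Rightarrow> bool" where
  "regularly_varying f \<rho> \<longleftrightarrow>
     f \<in> borel_measurable borel \<and> (\<forall>\<^sub>F x in at_top. 0 < f x) \<and>
     (\<forall>c>0. ((\<lambda>x. f (c * x) / f x) \<longlongrightarrow> c powr \<rho>) at_top)"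

definition tail :: "'a measure \<Rightarrow> ('a \<Rightarrow> real) \<Rightarrow> real \<Rightarrow> real" where
  "tail M X x = measure M {\<omega> \<in> space M. X \<omega> > x}"

definition integrated_tail :: "'a measure \<Rightarrow> ('a \<Rightarrow> real) \<Rightarrow> real \<Rightarrow> real \<Rightarrow> real" where
  "integrated_tail M X \<gamma> y = 1 / \<gamma> * (LINT x:{y..}|lborel. tail M X x)"

(* Sequences are indexed by i \<ge> 1. *)

definition num_points :: "(nat \<Rightarrow> 'a \<Rightarrow> real) \<Rightarrow> real \<Rightarrow> 'a \<Rightarrow> nat" where
  "num_points \<tau> t \<omega> = card {i. 1 \<le> i \<and> \<tau> i \<omega> \<le> t}"

definition cumulative_intensity :: "(real \<Rightarrow> real) \<Rightarrow> real \<Rightarrow> real" where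
  "cumulative_intensity lam t = (LINT s:{0..t}|lborel. lam s)"

definition intensity_function :: "(real \<Rightarrow> real) \<Rightarrow> bool" where
  "intensity_function lam \<longleftrightarrow>
     lam \<in> borel_measurable borel \<and> (\<forall>s\<ge>0. 0 \<le> lam s) \<and> (\<forall>t\<ge>0. set_integrable lborel {0..t} lam)"

(* Local finiteness has to be required explicitly: the cardinality of an infinite set is 0.
   The probability mass function is written out because poisson_pmf needs a positive rate. *)
definition inhomogeneous_poisson_points ::
  "'a measure \<Rightarrow> (real \<Rightarrow> real) \<Rightarrow> (nat \<Rightarrow> 'a \<Rightarrow> real) \<Rightarrow> bool" where
  "inhomogeneous_poisson_points M lam \<tau> \<longleftrightarrow>
     intensity_function lam \<and>
     (\<forall>i\<ge>1. \<tau> i \<in> borel_measurable M) \<and>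
     (AE \<omega> in M. (\<forall>i\<ge>1. 0 \<le> \<tau> i \<omega> \<and> \<tau> i \<omega> \<le> \<tau> (Suc i) \<omega>) \<and>
        (\<forall>t. finite {i. 1 \<le> i \<and> \<tau> i \<omega> \<le> t})) \<and>
     (AE \<omega> in M. num_points \<tau> 0 \<omega> = 0) \<and>
     (\<forall>s t k. 0 \<le> s \<longrightarrow> s < t \<longrightarrow>
        (let \<mu> = cumulative_intensity lam t - cumulative_intensity lam s in
         measure M {\<omega> \<in> space M. num_points \<tau> t \<omega> - num_points \<tau> s \<omega> = k} =
           exp (- \<mu>) * \<mu> ^ k / fact k)) \<and>
     (\<forall>u :: nat \<Rightarrow> real. 0 \<le> u 0 \<longrightarrow> mono u \<longrightarrow>
        prob_space.indep_vars M (\<lambda>_. count_space UNIV)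
          (\<lambda>k \<omega>. num_points \<tau> (u (Suc k)) \<omega> - num_points \<tau> (u k) \<omega>) UNIV)"

(* S is a sigma-algebra on a set of functions (t, s) \<mapsto> f t s for which the evaluation map
   (f, t, s) \<mapsto> f t s is jointly measurable. A measurable random function is a random element of
   such a space. Without joint measurability in f (for instance with the product sigma-algebra)
   the independence of h and \<tau> would not determine the law of h t \<tau>. *)
definition measurable_function_space :: "(real \<Rightarrow> real \<Rightarrow> real) measure \<Rightarrow> bool" where
  "measurable_function_space S \<longleftrightarrow>
     (\<lambda>(f, t, s). f t s) \<in> borel_measurable (S \<Otimes>\<^sub>M borel \<Otimes>\<^sub>M borel)"

(* h i for i \<ge> 1 are the shock functions; h 0 is the generic copy, which only has to have the
   same law. *)
definition iid_shock_functions ::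
  "'a measure \<Rightarrow> (real \<Rightarrow> real \<Rightarrow> real) measure \<Rightarrow> (nat \<Rightarrow> 'a \<Rightarrow> real \<Rightarrow> real \<Rightarrow> real) \<Rightarrow> bool" where
  "iid_shock_functions M S h \<longleftrightarrow>
     measurable_function_space S \<and>
     (\<forall>i. h i \<in> measurable M S) \<and>
     (\<forall>i. AE \<omega> in M. \<forall>t\<ge>0. \<forall>s\<ge>0. 0 \<le> h i \<omega> t s) \<and>
     (\<forall>i. distr M S (h i) = distr M S (h 0)) \<and>
     prob_space.indep_vars M (\<lambda>_. S) h {1..}"

definition shot_noise ::
  "(nat \<Rightarrow> 'a \<Rightarrow> real) \<Rightarrow> (nat \<Rightarrow> 'a \<Rightarrow> real \<Rightarrow> real \<Rightarrow> real) \<Rightarrow> (nat \<Rightarrow> 'a \<Rightarrow> real) \<Rightarrow>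
     real \<Rightarrow> 'a \<Rightarrow> real" where
  "shot_noise X h \<tau> t \<omega> = (\<Sum>i = 1..num_points \<tau> t \<omega>. X i \<omega> * h i \<omega> t (\<tau> i \<omega>))"

definition integrated_expected_severity ::
  "'a measure \<Rightarrow> (real \<Rightarrow> 'a \<Rightarrow> real) \<Rightarrow> real \<Rightarrow> real \<Rightarrow> real" where
  "integrated_expected_severity M Y T x =
     (LINT t:{0..T}|lborel. (\<integral>\<omega>. max 0 (Y t \<omega> - x) \<partial>M))"

end

theory Submission
  imports Defs
begin

text \<open>
  Conditionally on the shock functions and instants, $Y(t)$ is a weighted sum of the $X_i$ with
  weights $\theta_i = h_i(t, T_i)$. Since two shocks are jointly large with negligible probability,
  such a sum exceeds $y$ essentially only when a single summand does, so its tail is equivalent to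
  $\sum_i \theta_i^\alpha\, \overline F_X(y)$. A power bound on the ratio
  $\overline F_X(z) / \overline F_X(y)$ and the union bound dominate the conditional tail by
  $C\, \overline F_X(y)\, N^k \sum_{i \le N} (1 + \theta_i^p)$. Given $N(t) = n$ the unordered points are
  distributed like $n$ copies of $V_0^{(t)}$, so this bound is integrable in $(t, \omega)$; dominated
  convergence gives the tail of $Y(t)$, integrated over $t \in (0, T]$. Finally
  $E[(Y - x)_+] = \int_x^\infty P(Y > y)\, dy$, and asymptotic equivalence of tails passes to their
  integrals.
\<close>

section \<open>Tails of weighted sums\<close>

text \<open>The limit has to be dominated jointly in t and in the marks, and the integrable bounds
  at hand are \<open>E[N(t)]\<close> and \<open>E[N(t)] E[h_0(t, V_t)^p]\<close>. The union bound
  costs more: among n summands one exceeds \<open>y / n\<close>, not y, which produces a factor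
  \<open>N^k\<close> with \<open>k = nat \<lceil>p\<rceil>\<close>. It is absorbed by comparing
  Poisson weights with the weight at 1: the sum of \<open>n^(k+1) P(N = n)\<close> is at most a
  constant times \<open>P(N = 1)\<close>, hence times \<open>E[N]\<close>, with one constant for all
  t up to T. Dominated convergence can then be applied twice, over the marks at fixed t and over t.

  The shocks may depend on one another. Pairwise negligibility replaces independence: from below it
  controls the correction in a Bonferroni bound, from above it discards the sums that are large
  without one dominating summand, since these contain two fairly large ones.

  Equivalence to the zero function means eventual equality with zero, so a vanishing limit constant
  is a case of its own.\<close>

text \<open>A Potter-type bound reaching down to every \<open>z > 0\<close>. Since
  \<open>F (x/2) / F x\<close> tends to \<open>2 powr \<alpha> < 2 powr p\<close>, the function
  \<open>x powr p * F x\<close> does not decrease when a large x doubles; monotonicity of F bridges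
  the gap between dyadic points, and \<open>F \<le> 1\<close> handles small arguments.\<close>

lemma regularly_varying_power_bound:
  fixes F :: "real \<Rightarrow> real"
  assumes F: "regularly_varying F (- \<alpha>)" "antimono F" "\<And>x. 0 \<le> F x" "\<And>x. F x \<le> 1"
    and p: "\<alpha> < p" "0 < p"
  obtains C x0 where "0 < C" "0 < x0" "\<And>y. x0 \<le> y \<Longrightarrow> 0 < F y"
    "\<And>y z. x0 \<le> y \<Longrightarrow> 0 < z \<Longrightarrow> z \<le> y \<Longrightarrow> z powr p * F z \<le> C * (y powr p * F y)"
proof -
  have lim: "((\<lambda>x. F (1/2 * x) / F x) \<longlongrightarrow> (1/2) powr (- \<alpha>)) at_top"
    using F(1) unfolding regularly_varying_def by (elim conjE) (drule spec[of _ "1/2"], simp)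
  have "(1/2 :: real) powr (- \<alpha>) < 2 powr p"
    using p by (simp add: powr_minus_divide powr_divide)
  from order_tendstoD(2)[OF lim this] F(1)
  have "\<forall>\<^sub>F x in at_top. F (1/2 * x) / F x < 2 powr p \<and> 0 < F x"
    by (auto simp: regularly_varying_def eventually_conj_iff)
  then obtain a where a: "\<And>x. a \<le> x \<Longrightarrow> F (1/2 * x) / F x < 2 powr p \<and> 0 < F x"
    by (auto simp: eventually_at_top_linorder)
  define x0 where "x0 = max a 1"
  \<comment> \<open>The factor \<open>2 powr p\<close> pays for one incomplete dyadic step. The
    division by \<open>F (2 * x0) \<le> 1\<close> settles \<open>y \<le> 2 * x0\<close>, where only
    \<open>F z \<le> 1\<close> and \<open>F y \<ge> F (2 * x0)\<close> are used.\<close>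
  define C where "C = 2 powr p / F (2 * x0)"
  have x0: "0 < x0" "\<And>y. x0 \<le> y \<Longrightarrow> 0 < F y"
    using a by (auto simp: x0_def)
  have C: "2 powr p \<le> C" "0 < C"
    using F(4)[of "2 * x0"] x0(2)[of "2 * x0"] x0(1) by (auto simp: C_def field_simps)
  have step: "(x/2) powr p * F (x/2) \<le> x powr p * F x" if "x0 \<le> x" for x
  proof -
    have "F (x/2) \<le> 2 powr p * F x"
      using a[of x] that by (auto simp: x0_def field_simps)
    then have "(x/2) powr p * F (x/2) \<le> (x/2) powr p * (2 powr p * F x)"
      by (intro mult_left_mono) auto
    also have "\<dots> = x powr p * F x"
      using that x0 by (simp add: powr_divide)
    finally show ?thesis .
  qed
  \<comment> \<open>The number n bounds the halvings that bring y down to x0. It serves as induction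
    measure and is removed at the end by the Archimedean property.\<close>
  have bound: "z powr p * F z \<le> C * (y powr p * F y)" if "x0 \<le> y" "y \<le> 2 ^ n * x0" "0 < z" "z \<le> y" for n y z
    using that
  proof (induction n arbitrary: y)
    case (Suc n)
    show ?case
    proof (cases "y \<le> 2 * x0")
      case True
      have "z powr p * F z \<le> (2 * x0) powr p * 1"
        using Suc.prems True p x0 F by (intro mult_mono powr_mono2) auto
      also have "\<dots> = C * (x0 powr p * F (2 * x0))"
        using x0(2)[of "2 * x0"] x0(1) by (simp add: C_def powr_mult)
      also have "\<dots> \<le> C * (y powr p * F y)"
        using Suc.prems True p x0 F C by (intro mult_left_mono mult_mono powr_mono2 antimonoD[OF F(2)]) auto
      finally show ?thesis .
    next
      case False
      show ?thesis
      proof (cases "z \<le> y / 2")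
        case True
        have "z powr p * F z \<le> C * ((y/2) powr p * F (y/2))"
          using Suc.IH[of "y/2"] Suc.prems True False by auto
        also have "\<dots> \<le> C * (y powr p * F y)"
          using C step[of y] Suc.prems by (intro mult_left_mono) auto
        finally show ?thesis .
      next
        \<comment> \<open>Here z and y lie within one dyadic step, so both are compared at
          \<open>y / 2\<close>.\<close>
        case zy: False
        have "z powr p * F z \<le> y powr p * F (y/2)"
          using Suc.prems p zy F by (intro mult_mono powr_mono2 antimonoD[OF F(2)]) auto
        also have "\<dots> = 2 powr p * ((y/2) powr p * F (y/2))"
          using Suc.prems x0 by (simp add: powr_divide)
        also have "\<dots> \<le> C * (y powr p * F y)"
          using C F by (intro mult_mono[OF C(1) step[OF Suc.prems(1)]]) auto
        finally show ?thesis .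
      qed
    qed
  next
    case 0
    have "z powr p * F z \<le> y powr p * 1"
      using 0 p x0 F by (intro mult_mono powr_mono2) auto
    also have "\<dots> \<le> y powr p * (C * F y)"
    proof (intro mult_left_mono)
      have "1 \<le> 2 powr p" using p by (simp add: ge_one_powr_ge_zero)
      also have "\<dots> = C * F (2 * x0)"
        using x0(2)[of "2 * x0"] x0(1) by (simp add: C_def)
      also have "\<dots> \<le> C * F y"
        using 0 x0 C by (intro mult_left_mono antimonoD[OF F(2)]) auto
      finally show "1 \<le> C * F y" .
    qed auto
    finally show ?case by (simp add: mult_ac)
  qed
  show thesis
  proof (rule that[OF C(2) x0])
    fix y z assume "x0 \<le> y" "0 < z" "z \<le> y"
    obtain n where "y / x0 < 2 ^ n"
      using real_arch_pow[of 2 "y / x0"] by auto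
    then show "z powr p * F z \<le> C * (y powr p * F y)"
      using bound[of y n z] \<open>x0 \<le> y\<close> \<open>0 < z\<close> \<open>z \<le> y\<close> x0 by (auto simp: field_simps)
  qed auto
qed

lemma (in prob_space) antimono_tail: 
  assumes "X \<in> borel_measurable M" shows "antimono (tail M X)"
  unfolding tail_def using assms by (intro antimonoI finite_measure_mono) auto

text \<open>The event is \<open>X > y / c\<close>. For \<open>c \<le> 1\<close> monotonicity of the
  tail suffices and gives the summand 1; for \<open>c > 1\<close> the power bound with
  \<open>z = y / c\<close> gives \<open>c powr p\<close>.\<close>

lemma (in prob_space) tail_scaled_bound:
  fixes X :: "'a \<Rightarrow> real"
  assumes X: "X \<in> borel_measurable M"
    and rv: "regularly_varying (tail M X) (- \<alpha>)" and p: "\<alpha> < p" "0 < p"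
  obtains C x0 where "0 < C" "0 < x0" "\<And>y. x0 \<le> y \<Longrightarrow> 0 < tail M X y"
    "\<And>y c. x0 \<le> y \<Longrightarrow> 0 \<le> c \<Longrightarrow> prob {\<omega> \<in> space M. c * X \<omega> > y} \<le> C * (1 + c powr p) * tail M X y"
proof -
  obtain C x0 where C: "0 < C" "0 < x0" "\<And>y. x0 \<le> y \<Longrightarrow> 0 < tail M X y"
    "\<And>y z. x0 \<le> y \<Longrightarrow> 0 < z \<Longrightarrow> z \<le> y \<Longrightarrow> z powr p * tail M X z \<le> C * (y powr p * tail M X y)"
    using regularly_varying_power_bound[OF rv antimono_tail[OF X] _ _ p] by (auto simp: tail_def)
  show thesis
  proof (rule that[of "max 1 C"])
    fix y c :: real assume y: "x0 \<le> y" "0 \<le> c"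
    show "prob {\<omega> \<in> space M. c * X \<omega> > y} \<le> max 1 C * (1 + c powr p) * tail M X y"
    proof (cases "c = 0")
      case True
      then show ?thesis using y C by (auto simp: tail_def)
    next
      case False
      then have c: "0 < c" using y by auto
      have eq: "prob {\<omega> \<in> space M. c * X \<omega> > y} = tail M X (y / c)"
        using c by (simp add: tail_def field_simps)
      show ?thesis
      proof (cases "c \<le> 1")
        case True
        have "y * c \<le> y * 1" using True y C by (intro mult_left_mono) auto
        then have "tail M X (y / c) \<le> tail M X y"
          using c by (intro antimonoD[OF antimono_tail[OF X]]) (auto simp: field_simps)
        also have "\<dots> \<le> max 1 C * (1 + c powr p) * tail M X y"
        proof -
          have "1 * 1 \<le> max 1 C * (1 + c powr p)" by (intro mult_mono) auto
          from mult_right_mono[OF this, of "tail M X y"] show ?thesis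
            by (auto simp: tail_def)
        qed
        finally show ?thesis unfolding eq .
      next
        case False
        have "y * 1 \<le> y * c" using False y C by (intro mult_left_mono) auto
        then have "(y / c) powr p * tail M X (y / c) \<le> C * (y powr p * tail M X y)"
          using c y C by (intro C(4)) (auto simp: field_simps)
        then have "tail M X (y / c) \<le> C * c powr p * tail M X y"
          using c y C(2) by (simp add: powr_divide field_simps)
        also have "\<dots> \<le> max 1 C * (1 + c powr p) * tail M X y"
          by (intro mult_right_mono mult_mono) (auto simp: tail_def)
        finally show ?thesis unfolding eq .
      qed
    qed
  qed (use C in auto)
qed

text \<open>The threshold factor a stays free because bounding a sum from above needs the levels
  \<open>(1 - \<delta>) * y\<close> and \<open>\<delta> / n * y\<close> besides y itself. For
  \<open>c = 0\<close> the limit is 0 by the convention \<open>0 powr \<alpha> = 0\<close>.\<close>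

lemma (in prob_space) tail_scaled_limit:
  assumes rv: "regularly_varying F (- \<alpha>)" and F: "\<And>x. tail M X x = F x"
    and c: "0 \<le> c" and a: "0 < a"
  shows "((\<lambda>y. prob {\<omega> \<in> space M. a * y < c * X \<omega>} / F y) \<longlongrightarrow> c powr \<alpha> * a powr (- \<alpha>)) at_top"
proof (cases "c = 0")
  case True
  have "\<forall>\<^sub>F y in at_top. prob {\<omega> \<in> space M. a * y < c * X \<omega>} / F y = 0"
    using eventually_gt_at_top[of 0]
  proof eventually_elim
    case (elim y)
    then have "\<not> a * y < 0" using a by (simp add: not_less)
    then show ?case by (simp add: True)
  qed
  then show ?thesis using True by (simp add: tendsto_eventually)
next
  case False
  then have "0 < a / c" using c a by auto
  then have "((\<lambda>y. F (a / c * y) / F y) \<longlongrightarrow> (a / c) powr (- \<alpha>)) at_top"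
    using rv by (auto simp: regularly_varying_def)
  moreover have "prob {\<omega> \<in> space M. a * y < c * X \<omega>} = F (a / c * y)" for y
    using F[of "a / c * y"] False c by (simp add: tail_def field_simps)
  moreover have "(a / c) powr (- \<alpha>) = c powr \<alpha> * a powr (- \<alpha>)"
    using c a by (simp add: powr_divide powr_minus_divide)
  ultimately show ?thesis by simp
qed

text \<open>Both events force X and Y above the common level \<open>b * y\<close>, with b obtained
  from the larger coefficient. There the pair hypothesis applies, and regular variation compares
  \<open>F (b * y)\<close> with \<open>F y\<close>.\<close>

lemma (in prob_space) joint_tail_scaled_limit:
  fixes X Y :: "'a \<Rightarrow> real"
  assumes [measurable]: "X \<in> borel_measurable M" "Y \<in> borel_measurable M"
    and rv: "regularly_varying F (- \<alpha>)"
    and pair: "((\<lambda>x. prob {\<omega> \<in> space M. X \<omega> > x \<and> Y \<omega> > x} / F x) \<longlongrightarrow> 0) at_top"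
    and a: "0 < a" and c: "0 \<le> c" "0 \<le> d"
  shows "((\<lambda>y. prob {\<omega> \<in> space M. a * y < c * X \<omega> \<and> a * y < d * Y \<omega>} / F y) \<longlongrightarrow> 0) at_top"
proof -
  \<comment> \<open>The 1 inside the maximum keeps m positive when both coefficients vanish.\<close>
  define m where "m = max 1 (max c d)"
  define b where "b = a / m"
  have m: "0 < m" "c \<le> m" "d \<le> m" by (auto simp: m_def)
  have b: "0 < b" using a m by (simp add: b_def)
  have pos: "\<forall>\<^sub>F y in at_top. 0 < F y" using rv by (auto simp: regularly_varying_def)
  have at_top: "filterlim (\<lambda>y. b * y) at_top at_top"
    using b by (simp add: filterlim_tendsto_pos_mult_at_top[OF tendsto_const _ filterlim_ident])
  have "((\<lambda>y. prob {\<omega> \<in> space M. X \<omega> > b * y \<and> Y \<omega> > b * y} / F (b * y) * (F (b * y) / F y)) \<longlongrightarrow> 0 * b powr (- \<alpha>)) at_top"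
    using rv b by (intro tendsto_mult filterlim_compose[OF pair at_top]) (auto simp: regularly_varying_def)
  then have lim: "((\<lambda>y. prob {\<omega> \<in> space M. X \<omega> > b * y \<and> Y \<omega> > b * y} / F (b * y) * (F (b * y) / F y)) \<longlongrightarrow> 0) at_top"
    by simp
  show ?thesis
  proof (rule real_tendsto_sandwich[OF _ _ tendsto_const lim])
    show "\<forall>\<^sub>F y in at_top. 0 \<le> prob {\<omega> \<in> space M. a * y < c * X \<omega> \<and> a * y < d * Y \<omega>} / F y"
      using pos by eventually_elim auto
    show "\<forall>\<^sub>F y in at_top. prob {\<omega> \<in> space M. a * y < c * X \<omega> \<and> a * y < d * Y \<omega>} / F y
        \<le> prob {\<omega> \<in> space M. X \<omega> > b * y \<and> Y \<omega> > b * y} / F (b * y) * (F (b * y) / F y)"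
      using pos eventually_gt_at_top[of 0] filterlim_iff[THEN iffD1, OF at_top, rule_format, OF pos]
    proof eventually_elim
      case (elim y)
      have le: "b * y < x" if "a * y < k * x" "0 \<le> k" "k \<le> m" for k x :: real
      proof -
        have "0 < k * x" using that(1) a elim by (smt (verit) mult_pos_pos)
        then have "0 < x" using that(2) by (auto simp: zero_less_mult_iff)
        then have "k * x \<le> m * x" using that by (intro mult_right_mono) auto
        then have "a * y < m * x" using that(1) by simp
        then show ?thesis using m by (simp add: b_def field_simps)
      qed
      have "prob {\<omega> \<in> space M. a * y < c * X \<omega> \<and> a * y < d * Y \<omega>} \<le> prob {\<omega> \<in> space M. X \<omega> > b * y \<and> Y \<omega> > b * y}"
        using le[OF _ c(1) m(2)] le[OF _ c(2) m(3)] by (intro finite_measure_mono) auto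
      then show ?case using elim by (simp add: divide_right_mono)
    qed
  qed
qed

text \<open>A Bonferroni inequality. The sum runs over ordered pairs, so each intersection is
  subtracted twice; this is harmless because the whole correction is negligible later.\<close>

lemma (in prob_space) prob_Union_ge:
  assumes "finite I" and "\<And>i. i \<in> I \<Longrightarrow> A i \<in> events"
  shows "(\<Sum>i\<in>I. prob (A i)) - (\<Sum>(i, j)\<in>{(i, j) \<in> I \<times> I. i \<noteq> j}. prob (A i \<inter> A j)) \<le> prob (\<Union>i\<in>I. A i)"
  using assms
proof (induction I rule: finite_induct)
  case (insert a I)
  let ?P = "\<lambda>I. {(i, j) \<in> I \<times> I. i \<noteq> j}" and ?f = "\<lambda>(i, j). prob (A i \<inter> A j)"
  have "A a \<inter> (\<Union>i\<in>I. A i) = (\<Union>i\<in>I. A a \<inter> A i)" by auto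
  moreover have "prob (\<Union>i\<in>I. A a \<inter> A i) \<le> (\<Sum>i\<in>I. prob (A a \<inter> A i))"
    using insert by (intro finite_measure_subadditive_finite) auto
  moreover have "(\<Sum>x\<in>{a} \<times> I. ?f x) = (\<Sum>i\<in>I. prob (A a \<inter> A i))"
    by (subst sum.cartesian_product[symmetric]) auto
  moreover have "(\<Sum>x\<in>{a} \<times> I. ?f x) + (\<Sum>x\<in>?P I. ?f x) = (\<Sum>x\<in>{a} \<times> I \<union> ?P I. ?f x)"
    using insert by (intro sum.union_disjoint[symmetric]) (auto intro: finite_subset[of _ "I \<times> I"])
  moreover have "\<dots> \<le> (\<Sum>x\<in>?P (insert a I). ?f x)"
    using insert by (intro sum_mono2) (auto intro: finite_subset[of _ "insert a I \<times> insert a I"])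
  moreover have "prob (B \<union> C) = prob B + prob C - prob (B \<inter> C)" if "B \<in> events" "C \<in> events" for B C
    using that by (simp add: finite_measure_Union' finite_measure_Diff' Int_commute)
  from this[of "A a" "\<Union>i\<in>I. A i"]
  have "prob (A a \<union> (\<Union>i\<in>I. A i)) = prob (A a) + prob (\<Union>i\<in>I. A i) - prob (A a \<inter> (\<Union>i\<in>I. A i))"
    using insert by (auto intro!: sets.finite_UN)
  ultimately show ?case using insert by simp
qed simp

text \<open>If the largest summand is at most \<open>(1 - \<delta>) * y\<close>, the others add up
  to more than \<open>\<delta> * y\<close>, so one of them exceeds its share
  \<open>\<delta> / card I * y\<close>, and the largest exceeds that share too.\<close>

lemma single_big_jump:
  fixes v :: "'i \<Rightarrow> real"
  assumes I: "finite I" and y: "0 < y" "y < (\<Sum>i\<in>I. v i)" and \<delta>: "0 < \<delta>" "\<delta> < 1"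
    and small: "\<And>i. i \<in> I \<Longrightarrow> v i \<le> (1 - \<delta>) * y"
  obtains i j where "i \<in> I" "j \<in> I" "i \<noteq> j" "\<delta> / card I * y < v i" "\<delta> / card I * y < v j"
proof -
  have "I \<noteq> {}" using y by auto
  have "Max (v ` I) \<in> v ` I"
    using I \<open>I \<noteq> {}\<close> by (intro Max_in) auto
  then obtain i where i: "i \<in> I" "Max (v ` I) = v i"
    by (rule imageE) simp
  then have le: "\<And>j. j \<in> I \<Longrightarrow> v j \<le> v i"
    using I by (metis Max_ge finite_imageI imageI)
  have card: "0 < card I" using I \<open>I \<noteq> {}\<close> by (simp add: card_gt_0_iff)
  have "\<exists>j\<in>I - {i}. \<delta> / card I * y < v j"
  proof (rule ccontr)
    assume "\<not> ?thesis"
    then have "(\<Sum>j\<in>I - {i}. v j) \<le> (\<Sum>j\<in>I - {i}. \<delta> / card I * y)"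
      by (intro sum_mono) (auto simp: not_less)
    also have "\<dots> \<le> real (card I) * (\<delta> / card I * y)"
      using I i y \<delta> by (simp add: card_Diff_singleton mult_right_mono del: times_divide_eq_left times_divide_eq_right)
    also have "\<dots> = \<delta> * y" using card by simp
    finally have "(\<Sum>j\<in>I. v j) \<le> v i + \<delta> * y"
      using I i by (simp add: sum.remove)
    then show False using small[OF i(1)] y by (simp add: algebra_simps)
  qed
  then obtain j where "j \<in> I" "j \<noteq> i" "\<delta> / card I * y < v j" by auto
  then show thesis using that[of i j] i(1) le[of j] by auto
qed

text \<open>The sum exceeds y essentially when exactly one summand does. The two directions are
  proved separately, with deterministic weights c; the random weights are inserted later by freezing
  the marks.\<close>

lemma (in prob_space) weighted_sum_tail_limit:
  fixes X :: "'i \<Rightarrow> 'a \<Rightarrow> real"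
  assumes I: "finite I"
    and X[measurable]: "\<And>i. i \<in> I \<Longrightarrow> X i \<in> borel_measurable M"
    and nonneg: "\<And>i. i \<in> I \<Longrightarrow> AE \<omega> in M. 0 \<le> X i \<omega>"
    and F: "\<And>i x. i \<in> I \<Longrightarrow> tail M (X i) x = F x"
    and rv: "regularly_varying F (- \<alpha>)"
    and pair: "\<And>i j. i \<in> I \<Longrightarrow> j \<in> I \<Longrightarrow> i \<noteq> j \<Longrightarrow>
      ((\<lambda>x. prob {\<omega> \<in> space M. X i \<omega> > x \<and> X j \<omega> > x} / F x) \<longlongrightarrow> 0) at_top"
    and c: "\<And>i. i \<in> I \<Longrightarrow> 0 \<le> c i"
  shows "((\<lambda>y. prob {\<omega> \<in> space M. y < (\<Sum>i\<in>I. c i * X i \<omega>)} / F y) \<longlongrightarrow> (\<Sum>i\<in>I. c i powr \<alpha>)) at_top"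
proof -
  define P where "P = {(i, j) \<in> I \<times> I. i \<noteq> j}"
  define A where "A a y i = {\<omega> \<in> space M. a * y < c i * X i \<omega>}" for a y i
  have finP: "finite P" using I by (auto simp: P_def intro: finite_subset[of _ "I \<times> I"])
  have A[measurable]: "A a y i \<in> events" if "i \<in> I" for a y i using that by (simp add: A_def)
  let ?S = "\<lambda>y. {\<omega> \<in> space M. y < (\<Sum>i\<in>I. c i * X i \<omega>)}" and ?L = "\<Sum>i\<in>I. c i powr \<alpha>"
  have pos: "\<forall>\<^sub>F y in at_top. 0 < F y" using rv by (auto simp: regularly_varying_def)
  have single: "((\<lambda>y. (\<Sum>i\<in>I. prob (A a y i)) / F y) \<longlongrightarrow> ?L * a powr (- \<alpha>)) at_top" if "0 < a" for a
    unfolding sum_divide_distrib sum_distrib_right A_def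
    using tail_scaled_limit[OF rv F c that] by (intro tendsto_sum) auto
  have double: "((\<lambda>y. (\<Sum>(i, j)\<in>P. prob (A a y i \<inter> A a y j)) / F y) \<longlongrightarrow> 0) at_top" if "0 < a" for a
  proof -
    have "A a y i \<inter> A a y j = {\<omega> \<in> space M. a * y < c i * X i \<omega> \<and> a * y < c j * X j \<omega>}" for y i j
      by (auto simp: A_def)
    then show ?thesis
      unfolding sum_divide_distrib using joint_tail_scaled_limit[OF _ _ rv pair that] c
      by (intro tendsto_null_sum) (auto simp: P_def)
  qed
  show ?thesis
  proof (rule order_tendstoI)
    \<comment> \<open>Lower bound: all summands are nonnegative, so one summand above y suffices,
      and the Bonferroni correction is negligible.\<close>
    fix l assume l: "l < ?L"
    have "((\<lambda>y. (\<Sum>i\<in>I. prob (A 1 y i)) / F y - (\<Sum>(i, j)\<in>P. prob (A 1 y i \<inter> A 1 y j)) / F y) \<longlongrightarrow> ?L * 1 powr (- \<alpha>) - 0) at_top"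
      by (intro tendsto_diff single double) auto
    then have "\<forall>\<^sub>F y in at_top. l < (\<Sum>i\<in>I. prob (A 1 y i)) / F y - (\<Sum>(i, j)\<in>P. prob (A 1 y i \<inter> A 1 y j)) / F y"
      using l by (intro order_tendstoD(1)) auto
    then show "\<forall>\<^sub>F y in at_top. l < prob (?S y) / F y"
      using pos
    proof eventually_elim
      case (elim y)
      have "AE \<omega> in M. \<forall>i\<in>I. 0 \<le> X i \<omega>"
        using nonneg I by (simp add: AE_ball_countable countable_finite)
      then have "AE \<omega> in M. \<omega> \<in> (\<Union>i\<in>I. A 1 y i) \<longrightarrow> \<omega> \<in> ?S y"
      proof eventually_elim
        case (elim \<omega>)
        show ?case
        proof
          assume "\<omega> \<in> (\<Union>i\<in>I. A 1 y i)"
          then obtain i where i: "i \<in> I" "\<omega> \<in> space M" "y < c i * X i \<omega>" by (auto simp: A_def)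
          have "c i * X i \<omega> \<le> (\<Sum>i\<in>I. c i * X i \<omega>)"
            using I i c elim by (intro member_le_sum) auto
          then show "\<omega> \<in> ?S y" using i by auto
        qed
      qed
      then have "prob (\<Union>i\<in>I. A 1 y i) \<le> prob (?S y)"
        using I by (intro finite_measure_mono_AE) auto
      with prob_Union_ge[of I "A 1 y"] I have "(\<Sum>i\<in>I. prob (A 1 y i)) - (\<Sum>(i, j)\<in>P. prob (A 1 y i \<inter> A 1 y j)) \<le> prob (?S y)"
        by (auto simp: P_def)
      from divide_right_mono[OF this, of "F y"] elim show ?case
        by (simp add: diff_divide_distrib)
    qed
  next
    \<comment> \<open>Upper bound: \<delta> is taken so small that lowering the threshold to
      \<open>(1 - \<delta>) * y\<close> inflates the limit by a factor that still leaves it below u.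
      What remains has two summands above \<open>b * y\<close>.\<close>
    fix u assume u: "?L < u"
    have "((\<lambda>\<delta>. ?L * (1 - \<delta>) powr (- \<alpha>)) \<longlongrightarrow> ?L * (1 - 0) powr (- \<alpha>)) (at_right 0)"
      by (intro tendsto_intros) auto
    then have "\<forall>\<^sub>F \<delta> in at_right 0. ?L * (1 - \<delta>) powr (- \<alpha>) < u"
      using u by (intro order_tendstoD(2)) auto
    moreover have "\<forall>\<^sub>F \<delta> in at_right (0::real). \<delta> < 1" "\<forall>\<^sub>F \<delta> in at_right (0::real). 0 < \<delta>"
      by (auto simp: eventually_at_right_less eventually_at_right_field intro: exI[of _ 1])
    ultimately have "\<forall>\<^sub>F \<delta> in at_right 0. ?L * (1 - \<delta>) powr (- \<alpha>) < u \<and> \<delta> < 1 \<and> 0 < \<delta>"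
      by eventually_elim auto
    then obtain \<delta> where \<delta>: "?L * (1 - \<delta>) powr (- \<alpha>) < u" "0 < \<delta>" "\<delta> < 1"
      using eventually_happens'[of "at_right (0::real)"] by auto
    show "\<forall>\<^sub>F y in at_top. prob (?S y) / F y < u"
    \<comment> \<open>For empty I the share b would be 0, a division by \<open>card I = 0\<close>,
      and the pair estimate needs a positive level.\<close>
    proof (cases "I = {}")
      case True
      show ?thesis
        using eventually_gt_at_top[of 0]
      proof eventually_elim
        case (elim y)
        then have "?S y = {}" using True by auto
        then show ?case using u True by (simp only: measure_empty) simp
      qed
    next
      case False
      define b where "b = \<delta> / card I"
      have b: "0 < b" using \<delta> False I by (simp add: b_def card_gt_0_iff)
      have "((\<lambda>y. (\<Sum>i\<in>I. prob (A (1 - \<delta>) y i)) / F y + (\<Sum>(i, j)\<in>P. prob (A b y i \<inter> A b y j)) / F y) \<longlongrightarrow> ?L * (1 - \<delta>) powr (- \<alpha>) + 0) at_top"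
        using b \<delta> by (intro tendsto_add single double) auto
      then have "\<forall>\<^sub>F y in at_top. (\<Sum>i\<in>I. prob (A (1 - \<delta>) y i)) / F y + (\<Sum>(i, j)\<in>P. prob (A b y i \<inter> A b y j)) / F y < u"
        using \<delta> by (intro order_tendstoD(2)) auto
      then show ?thesis
        using pos eventually_gt_at_top[of 0]
      proof eventually_elim
        case (elim y)
        have "?S y \<subseteq> (\<Union>i\<in>I. A (1 - \<delta>) y i) \<union> (\<Union>(i, j)\<in>P. A b y i \<inter> A b y j)"
        proof
          fix \<omega> assume \<omega>: "\<omega> \<in> ?S y"
          show "\<omega> \<in> (\<Union>i\<in>I. A (1 - \<delta>) y i) \<union> (\<Union>(i, j)\<in>P. A b y i \<inter> A b y j)"
          proof (cases "\<exists>i\<in>I. (1 - \<delta>) * y < c i * X i \<omega>")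
            case True
            then show ?thesis using \<omega> by (auto simp: A_def)
          next
            case False
            then obtain i j where "i \<in> I" "j \<in> I" "i \<noteq> j" "b * y < c i * X i \<omega>" "b * y < c j * X j \<omega>"
              using single_big_jump[OF I elim(3) _ \<delta>(2,3), of "\<lambda>i. c i * X i \<omega>"] \<omega>
              by (auto simp: not_less b_def)
            then show ?thesis using \<omega> by (auto simp: A_def P_def)
          qed
        qed
        then have "prob (?S y) \<le> prob ((\<Union>i\<in>I. A (1 - \<delta>) y i) \<union> (\<Union>(i, j)\<in>P. A b y i \<inter> A b y j))"
          using I finP by (intro finite_measure_mono sets.Un sets.finite_UN) (auto simp: P_def)
        also have "\<dots> \<le> prob (\<Union>i\<in>I. A (1 - \<delta>) y i) + prob (\<Union>(i, j)\<in>P. A b y i \<inter> A b y j)"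
          using I finP by (intro measure_Un_le sets.finite_UN) (auto simp: P_def)
        also have "\<dots> \<le> (\<Sum>i\<in>I. prob (A (1 - \<delta>) y i)) + (\<Sum>x\<in>P. prob (case x of (i, j) \<Rightarrow> A b y i \<inter> A b y j))"
          using I finP by (intro add_mono finite_measure_subadditive_finite) (auto simp: P_def)
        also have "\<dots> = (\<Sum>i\<in>I. prob (A (1 - \<delta>) y i)) + (\<Sum>(i, j)\<in>P. prob (A b y i \<inter> A b y j))"
          by (simp add: case_prod_unfold)
        finally have "prob (?S y) / F y \<le> ((\<Sum>i\<in>I. prob (A (1 - \<delta>) y i)) + (\<Sum>(i, j)\<in>P. prob (A b y i \<inter> A b y j))) / F y"
          using elim by (intro divide_right_mono) auto
        then show ?case using elim by (simp add: add_divide_distrib)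
      qed
    qed
  qed
qed

text \<open>If the sum exceeds y, some \<open>n * c i * X i\<close> does, and the scaled bound
  yields \<open>(n * c i) powr p\<close>. The constants C and x0 depend neither on n nor on c, which
  makes the bound usable for random weights. Rounding p up to a natural exponent turns the factor in
  n into a moment of the Poisson count.\<close>

lemma (in prob_space) weighted_sum_tail_bound:
  fixes X :: "nat \<Rightarrow> 'a \<Rightarrow> real"
  assumes X[measurable]: "\<And>i. i \<ge> 1 \<Longrightarrow> X i \<in> borel_measurable M"
    and F: "\<And>i x. i \<ge> 1 \<Longrightarrow> tail M (X i) x = F x"
    and rv: "regularly_varying F (- \<alpha>)" and p: "\<alpha> < p" "0 < p"
  obtains C x0 where "0 < C" "0 < x0" "\<And>y. x0 \<le> y \<Longrightarrow> 0 < F y"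
    "\<And>y n c. x0 \<le> y \<Longrightarrow> (\<And>i. i \<in> {1..n} \<Longrightarrow> 0 \<le> c i) \<Longrightarrow>
      prob {\<omega> \<in> space M. y < (\<Sum>i=1..n. c i * X i \<omega>)} \<le>
        C * F y * (real n ^ nat \<lceil>p\<rceil> * (\<Sum>i=1..n. 1 + c i powr p))"
proof -
  have F1: "tail M (X 1) = F" using F by auto
  obtain C x0 where C: "0 < C" "0 < x0" "\<And>y. x0 \<le> y \<Longrightarrow> 0 < F y"
    "\<And>y c. x0 \<le> y \<Longrightarrow> 0 \<le> c \<Longrightarrow> prob {\<omega> \<in> space M. c * X 1 \<omega> > y} \<le> C * (1 + c powr p) * F y"
    using tail_scaled_bound[of "X 1" \<alpha> p] rv p F1 by auto
  have C': "prob {\<omega> \<in> space M. c * X i \<omega> > y} \<le> C * (1 + c powr p) * F y"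
    if "x0 \<le> y" "0 \<le> c" "i \<ge> 1" for y c i
  proof (cases "c = 0")
    case True
    then show ?thesis using C that by (auto simp: less_imp_le)
  next
    case False
    then have "prob {\<omega> \<in> space M. c * X i \<omega> > y} = tail M (X i) (y / c)" for i
      using that by (simp add: tail_def field_simps)
    then show ?thesis using C(4)[OF that(1,2)] F that by simp
  qed
  show thesis
  proof (rule that[OF C(1-3)])
    fix y :: real and n and c :: "nat \<Rightarrow> real"
    assume y: "x0 \<le> y" and c: "\<And>i. i \<in> {1..n} \<Longrightarrow> 0 \<le> c i"
    show "prob {\<omega> \<in> space M. y < (\<Sum>i=1..n. c i * X i \<omega>)} \<le>
        C * F y * (real n ^ nat \<lceil>p\<rceil> * (\<Sum>i=1..n. 1 + c i powr p))"
    proof (cases "n = 0")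
      case True
      then show ?thesis using y C(2) by simp
    next
      case False
      have "{\<omega> \<in> space M. y < (\<Sum>i=1..n. c i * X i \<omega>)} \<subseteq> (\<Union>i\<in>{1..n}. {\<omega> \<in> space M. (n * c i) * X i \<omega> > y})"
      proof (rule subsetI, rule ccontr)
        fix \<omega> assume \<omega>: "\<omega> \<in> {\<omega> \<in> space M. y < (\<Sum>i=1..n. c i * X i \<omega>)}"
          and "\<omega> \<notin> (\<Union>i\<in>{1..n}. {\<omega> \<in> space M. (n * c i) * X i \<omega> > y})"
        then have "c i * X i \<omega> \<le> y / n" if "i \<in> {1..n}" for i
          using that False by (auto simp: not_less field_simps)
        then have "(\<Sum>i=1..n. c i * X i \<omega>) \<le> (\<Sum>i=1..n. y / n)" by (intro sum_mono)
        then show False using \<omega> False by simp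
      qed
      then have "prob {\<omega> \<in> space M. y < (\<Sum>i=1..n. c i * X i \<omega>)} \<le> prob (\<Union>i\<in>{1..n}. {\<omega> \<in> space M. (n * c i) * X i \<omega> > y})"
        by (intro finite_measure_mono) auto
      also have "\<dots> \<le> (\<Sum>i=1..n. prob {\<omega> \<in> space M. (n * c i) * X i \<omega> > y})"
        by (intro finite_measure_subadditive_finite) auto
      also have "\<dots> \<le> (\<Sum>i=1..n. C * F y * (real n ^ nat \<lceil>p\<rceil> * (1 + c i powr p)))"
      proof (intro sum_mono)
        fix i assume i: "i \<in> {1..n}"
        have le: "real n powr p \<le> real n ^ nat \<lceil>p\<rceil>"
        proof -
          have "real n powr p \<le> real n powr real (nat \<lceil>p\<rceil>)"
            using False p by (intro powr_mono) (auto simp: le_nat_iff real_nat_ceiling_ge)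
          then show ?thesis using False by (simp add: powr_realpow)
        qed
        have "1 + (n * c i) powr p \<le> real n ^ nat \<lceil>p\<rceil> * (1 + c i powr p)"
        proof -
          have "1 \<le> real n ^ nat \<lceil>p\<rceil>" using False by (intro one_le_power) auto
          moreover have "(n * c i) powr p \<le> real n ^ nat \<lceil>p\<rceil> * c i powr p"
            using c[OF i] le by (simp add: powr_mult mult_right_mono)
          ultimately show ?thesis by (simp add: distrib_left)
        qed
        then have "C * F y * (1 + (n * c i) powr p) \<le> C * F y * (real n ^ nat \<lceil>p\<rceil> * (1 + c i powr p))"
          using C y by (intro mult_left_mono) (auto simp: less_imp_le)
        then show "prob {\<omega> \<in> space M. (n * c i) * X i \<omega> > y} \<le> C * F y * (real n ^ nat \<lceil>p\<rceil> * (1 + c i powr p))"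
          using C'[OF y, of "n * c i" i] c[OF i] i by (simp add: mult_ac)
      qed
      also have "\<dots> = C * F y * (real n ^ nat \<lceil>p\<rceil> * (\<Sum>i=1..n. 1 + c i powr p))"
        by (simp only: sum_distrib_left)
      finally show ?thesis .
    qed
  qed
qed

section \<open>Independence and measurability\<close>

lemma (in prob_space) indep_elements_distr_pair:
  assumes "indep_elements M A X B Y"
  shows "distr M A X \<Otimes>\<^sub>M distr M B Y = distr M (A \<Otimes>\<^sub>M B) (\<lambda>\<omega>. (X \<omega>, Y \<omega>))"
proof -
  have [measurable]: "X \<in> measurable M A" "Y \<in> measurable M B"
    and indep: "indep_set {X -` U \<inter> space M |U. U \<in> sets A} {Y -` U \<inter> space M |U. U \<in> sets B}"
    using assms by (auto simp: indep_elements_def)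
  interpret X: prob_space "distr M A X" by (rule prob_space_distr) simp
  interpret Y: prob_space "distr M B Y" by (rule prob_space_distr) simp
  show ?thesis
  proof (rule pair_measure_eqI)
    fix U V assume UV: "U \<in> sets (distr M A X)" "V \<in> sets (distr M B Y)"
    then have [measurable]: "U \<in> sets A" "V \<in> sets B" by auto
    have "(\<lambda>\<omega>. (X \<omega>, Y \<omega>)) -` (U \<times> V) \<inter> space M = (X -` U \<inter> space M) \<inter> (Y -` V \<inter> space M)"
      by auto
    moreover have "prob ((X -` U \<inter> space M) \<inter> (Y -` V \<inter> space M)) = prob (X -` U \<inter> space M) * prob (Y -` V \<inter> space M)"
      using UV by (intro indep_setD[OF indep]) auto
    ultimately show "emeasure (distr M A X) U * emeasure (distr M B Y) V =
        emeasure (distr M (A \<Otimes>\<^sub>M B) (\<lambda>\<omega>. (X \<omega>, Y \<omega>))) (U \<times> V)"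
      by (simp add: emeasure_distr emeasure_eq_measure ennreal_mult)
  qed (auto intro: X.sigma_finite_measure_axioms Y.sigma_finite_measure_axioms intro!: sets_pair_measure_cong)
qed

text \<open>Conditioning is expressed in this form below: the second element is read at an
  independent sample point \<omega>', and the first one is integrated while \<omega>' is
  frozen.\<close>

lemma (in prob_space) indep_elements_nn_integral:
  assumes indep: "indep_elements M A X B Y" and f[measurable]: "f \<in> borel_measurable (A \<Otimes>\<^sub>M B)"
  shows "(\<integral>\<^sup>+\<omega>. f (X \<omega>, Y \<omega>) \<partial>M) = (\<integral>\<^sup>+\<omega>'. \<integral>\<^sup>+\<omega>. f (X \<omega>, Y \<omega>') \<partial>M \<partial>M)"
proof -
  have [measurable]: "X \<in> measurable M A" "Y \<in> measurable M B"
    using indep by (auto simp: indep_elements_def)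
  interpret X: prob_space "distr M A X" by (rule prob_space_distr) simp
  interpret Y: prob_space "distr M B Y" by (rule prob_space_distr) simp
  interpret pair_sigma_finite "distr M A X" "distr M B Y" ..
  have "(\<integral>\<^sup>+\<omega>. f (X \<omega>, Y \<omega>) \<partial>M) = (\<integral>\<^sup>+z. f z \<partial>(distr M A X \<Otimes>\<^sub>M distr M B Y))"
    unfolding indep_elements_distr_pair[OF indep] by (simp add: nn_integral_distr)
  also have "\<dots> = (\<integral>\<^sup>+y. \<integral>\<^sup>+x. f (x, y) \<partial>distr M A X \<partial>distr M B Y)"
    by (rule nn_integral_snd[symmetric]) simp
  also have "\<dots> = (\<integral>\<^sup>+\<omega>'. \<integral>\<^sup>+\<omega>. f (X \<omega>, Y \<omega>') \<partial>M \<partial>M)"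
    by (subst nn_integral_distr, simp, simp, intro nn_integral_cong, subst nn_integral_distr)
       (auto dest: measurable_space[OF \<open>Y \<in> measurable M B\<close>])
  finally show ?thesis .
qed

text \<open>Tonelli for the indicator of \<open>x \<le> y < Z\<close>. Sigma-finiteness is the right
  generality because the identity is applied both to M and to the product of M with the time
  measure.\<close>

lemma nn_integral_excess:
  fixes Z :: "'a \<Rightarrow> real"
  assumes "sigma_finite_measure M" and [measurable]: "Z \<in> borel_measurable M"
  shows "(\<integral>\<^sup>+\<omega>. ennreal (max 0 (Z \<omega> - x)) \<partial>M) = (\<integral>\<^sup>+y\<in>{x..}. emeasure M {\<omega> \<in> space M. y < Z \<omega>} \<partial>lborel)"
proof -
  interpret M: sigma_finite_measure M by fact
  interpret pair_sigma_finite M lborel ..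
  have "(\<integral>\<^sup>+\<omega>. ennreal (max 0 (Z \<omega> - x)) \<partial>M) = (\<integral>\<^sup>+\<omega>. \<integral>\<^sup>+y. indicator {x..<Z \<omega>} y \<partial>lborel \<partial>M)"
    by (intro nn_integral_cong) (simp add: max_def)
  also have "\<dots> = (\<integral>\<^sup>+\<omega>. \<integral>\<^sup>+y. (if x \<le> y \<and> y < Z \<omega> then 1 else 0) \<partial>lborel \<partial>M)"
    by (intro nn_integral_cong) (auto simp: indicator_def)
  also have "\<dots> = (\<integral>\<^sup>+y. \<integral>\<^sup>+\<omega>. (if x \<le> y \<and> y < Z \<omega> then 1 else 0) \<partial>M \<partial>lborel)"
    by (rule Fubini'[symmetric]) measurable
  also have "\<dots> = (\<integral>\<^sup>+y\<in>{x..}. emeasure M {\<omega> \<in> space M. y < Z \<omega>} \<partial>lborel)"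
  proof (intro nn_integral_cong)
    fix y
    have "(\<integral>\<^sup>+\<omega>. (if x \<le> y \<and> y < Z \<omega> then 1 else 0) \<partial>M) =
        (\<integral>\<^sup>+\<omega>. indicator {x..} y * indicator {\<omega> \<in> space M. y < Z \<omega>} \<omega> \<partial>M)"
      by (intro nn_integral_cong) (auto simp: indicator_def)
    then show "(\<integral>\<^sup>+\<omega>. (if x \<le> y \<and> y < Z \<omega> then 1 else 0) \<partial>M) =
        emeasure M {\<omega> \<in> space M. y < Z \<omega>} * indicator {x..} y"
      by (simp add: nn_integral_cmult mult.commute)
  qed
  finally show ?thesis .
qed

text \<open>The cardinality is written as a series of indicators. The default values agree for
  infinite index sets: \<open>card\<close> gives 0, and \<open>enn2real\<close> of infinity is
  0.\<close>

lemma measurable_num_points: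
  assumes [measurable]: "\<And>i. 1 \<le> i \<Longrightarrow> \<tau> i \<in> borel_measurable M"
  shows "(\<lambda>(t, \<omega>). num_points \<tau> t \<omega>) \<in> borel \<Otimes>\<^sub>M M \<rightarrow>\<^sub>M count_space UNIV"
proof -
  have card: "real (num_points \<tau> t \<omega>) = enn2real (\<Sum>i. if 1 \<le> i \<and> \<tau> i \<omega> \<le> t then 1 else 0)" for t \<omega>
  proof -
    have "real (num_points \<tau> t \<omega>) = measure (count_space UNIV) {i. 1 \<le> i \<and> \<tau> i \<omega> \<le> t}"
      unfolding num_points_def by (simp add: Measure_Space.measure_count_space)
    also have "\<dots> = enn2real (\<integral>\<^sup>+i. indicator {i. 1 \<le> i \<and> \<tau> i \<omega> \<le> t} i \<partial>count_space UNIV)"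
      by (simp add: measure_def)
    also have "\<dots> = enn2real (\<Sum>i. indicator {i. 1 \<le> i \<and> \<tau> i \<omega> \<le> t} i)"
      by (simp only: nn_integral_count_space_nat)
    finally show ?thesis by (simp add: indicator_def of_bool_def)
  qed
  have [measurable]: "Measurable.pred (borel \<Otimes>\<^sub>M M) (\<lambda>z. 1 \<le> i \<and> \<tau> i (snd z) \<le> fst z)" for i
    by (cases "1 \<le> i") measurable
  have "(\<lambda>(t, \<omega>). num_points \<tau> t \<omega>) = (\<lambda>z. nat \<lfloor>enn2real (\<Sum>i. if 1 \<le> i \<and> \<tau> i (snd z) \<le> fst z then 1 else 0)\<rfloor>)"
    by (simp only: card[symmetric] case_prod_unfold) simp
  also have "\<dots> \<in> borel \<Otimes>\<^sub>M M \<rightarrow>\<^sub>M count_space UNIV" by measurable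
  finally show ?thesis .
qed

lemma measurable_sum_num_points:
  fixes f :: "nat \<Rightarrow> real \<Rightarrow> 'a \<Rightarrow> 'b :: {second_countable_topology, topological_comm_monoid_add}"
  assumes "\<And>i. 1 \<le> i \<Longrightarrow> \<tau> i \<in> borel_measurable M"
    and [measurable]: "\<And>i. 1 \<le> i \<Longrightarrow> (\<lambda>(t, \<omega>). f i t \<omega>) \<in> borel_measurable (borel \<Otimes>\<^sub>M M)"
  shows "(\<lambda>(t, \<omega>). \<Sum>i=1..num_points \<tau> t \<omega>. f i t \<omega>) \<in> borel_measurable (borel \<Otimes>\<^sub>M M)"
proof -
  note [measurable] = measurable_num_points[OF assms(1)]
  have "(\<lambda>z. \<Sum>i=1..(case z of (t, \<omega>) \<Rightarrow> num_points \<tau> t \<omega>). (case z of (t, \<omega>) \<Rightarrow> f i t \<omega>)) \<in> borel_measurable (borel \<Otimes>\<^sub>M M)"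
    by (rule measurable_compose_countable[where f="\<lambda>n z. \<Sum>i=1..n. (case z of (t, \<omega>) \<Rightarrow> f i t \<omega>)"])
       (auto intro!: borel_measurable_sum assms)
  then show ?thesis by (simp add: case_prod_unfold)
qed

text \<open>Joint measurability of evaluation is what allows the random instant to be inserted as an
  argument.\<close>

lemma measurable_random_function:
  assumes S: "measurable_function_space S"
    and [measurable]: "h \<in> measurable M S" "\<tau> \<in> borel_measurable M"
  shows "(\<lambda>(t, \<omega>). h \<omega> t (\<tau> \<omega>)) \<in> borel_measurable (borel \<Otimes>\<^sub>M M)"
proof -
  have "(\<lambda>z. (h (snd z), fst z, \<tau> (snd z))) \<in> borel \<Otimes>\<^sub>M M \<rightarrow>\<^sub>M S \<Otimes>\<^sub>M borel \<Otimes>\<^sub>M borel"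
    by measurable
  from measurable_compose[OF this S[unfolded measurable_function_space_def]]
  show ?thesis by (simp add: case_prod_unfold)
qed

lemma measurable_shot_noise:
  assumes S: "measurable_function_space S"
    and [measurable]: "\<And>i. 1 \<le> i \<Longrightarrow> X i \<in> borel_measurable M" "\<And>i. 1 \<le> i \<Longrightarrow> h i \<in> measurable M S"
      "\<And>i. 1 \<le> i \<Longrightarrow> \<tau> i \<in> borel_measurable M"
  shows "(\<lambda>(t, \<omega>). shot_noise X h \<tau> t \<omega>) \<in> borel_measurable (borel \<Otimes>\<^sub>M M)"
proof -
  have "(\<lambda>(t, \<omega>). X i \<omega> * h i \<omega> t (\<tau> i \<omega>)) \<in> borel_measurable (borel \<Otimes>\<^sub>M M)" if "1 \<le> i" for i
    using that measurable_random_function[OF S, of "h i" M "\<tau> i"] by (simp add: case_prod_unfold)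
  from measurable_sum_num_points[OF _ this, of \<tau>] assms(4) show ?thesis
    by (simp add: shot_noise_def)
qed

section \<open>Points of the Poisson process\<close>

lemma finite_initial_segment:
  fixes D :: "nat set"
  assumes "finite D" "\<And>i. i \<in> D \<Longrightarrow> 1 \<le> i" "\<And>i j. i \<in> D \<Longrightarrow> 1 \<le> j \<Longrightarrow> j \<le> i \<Longrightarrow> j \<in> D"
  shows "D = {1..card D}"
proof (cases "D = {}")
  case False
  have "D = {1..Max D}"
    using assms(2) assms(3)[OF Max_in[OF assms(1) False]] Max_ge[OF assms(1)]
    by (intro equalityI subsetI) (simp_all only: atLeastAtMost_iff)
  moreover from arg_cong[OF this, of card] have "card D = Max D" by simp
  ultimately show ?thesis by simp
qed simp

lemma inhomogeneous_poisson_pointsD: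
  assumes "inhomogeneous_poisson_points M lam \<tau>"
  shows "\<And>i. 1 \<le> i \<Longrightarrow> \<tau> i \<in> borel_measurable M"
    and "AE \<omega> in M. (\<forall>i\<ge>1. 0 \<le> \<tau> i \<omega> \<and> \<tau> i \<omega> \<le> \<tau> (Suc i) \<omega>) \<and> (\<forall>t. finite {i. 1 \<le> i \<and> \<tau> i \<omega> \<le> t})"
    and "AE \<omega> in M. num_points \<tau> 0 \<omega> = 0"
    and "intensity_function lam"
  using assms by (auto simp: inhomogeneous_poisson_points_def)

text \<open>The instants increase, so the indices with instant at most t are closed downwards; being
  finite, they form an initial segment. This reconciles the count \<open>num_points\<close> with the
  summation range of the shot noise.\<close>

lemma points_before_eq:
  assumes "(\<forall>i\<ge>1. 0 \<le> \<tau> i \<omega> \<and> \<tau> i \<omega> \<le> \<tau> (Suc i) \<omega>) \<and> (\<forall>t. finite {i. 1 \<le> i \<and> \<tau> i \<omega> \<le> t})"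
  shows "{i. 1 \<le> i \<and> \<tau> i \<omega> \<le> t} = {1..num_points \<tau> t \<omega>}"
  unfolding num_points_def
proof (rule finite_initial_segment)
  fix i j assume i: "i \<in> {i. 1 \<le> i \<and> \<tau> i \<omega> \<le> t}" and j: "1 \<le> j" "j \<le> i"
  have "\<tau> j \<omega> \<le> \<tau> i \<omega>"
    using j(2)
  proof (induction rule: dec_induct)
    case (step n)
    then have "\<tau> n \<omega> \<le> \<tau> (Suc n) \<omega>" using assms j(1) by auto
    with step.IH show ?case by (rule order_trans)
  qed simp
  then show "j \<in> {i. 1 \<le> i \<and> \<tau> i \<omega> \<le> t}" using i j by auto
qed (use assms in auto)

lemma cumulative_intensity_0: "cumulative_intensity lam 0 = 0"
  unfolding cumulative_intensity_def set_lebesgue_integral_def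
  by (rule integral_eq_zero_AE) (use AE_lborel_singleton[of 0] in eventually_elim, auto)

lemma cumulative_intensity_mono:
  assumes "intensity_function lam" "0 \<le> s" "s \<le> t"
  shows "cumulative_intensity lam s \<le> cumulative_intensity lam t"
  unfolding cumulative_intensity_def set_lebesgue_integral_def
  using assms by (intro integral_mono) (auto simp: intensity_function_def set_integrable_def split: split_indicator)

lemma emeasure_intensity:
  assumes "intensity_function lam" "0 \<le> t"
  shows "(\<integral>\<^sup>+s\<in>{0..t}. ennreal (lam s) \<partial>lborel) = ennreal (cumulative_intensity lam t)"
proof -
  have "(\<integral>\<^sup>+s\<in>{0..t}. ennreal (lam s) \<partial>lborel) = (\<integral>\<^sup>+s. ennreal (indicator {0..t} s * lam s) \<partial>lborel)"
    by (intro nn_integral_cong) (auto split: split_indicator)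
  also have "\<dots> = ennreal (cumulative_intensity lam t)"
    unfolding cumulative_intensity_def set_lebesgue_integral_def real_scaleR_def
    using assms by (intro nn_integral_eq_integral) (auto simp: intensity_function_def set_integrable_def split: split_indicator)
  finally show ?thesis .
qed

section \<open>Poisson weights, binomial splitting and uniform moment bounds\<close>

text \<open>The Poisson mass function with rate 0 allowed; there it is the point mass at 0, because
  \<open>0 ^ 0 = 1\<close>. Intervals carrying no intensity need this case.\<close>

definition poisson_weight :: "real \<Rightarrow> nat \<Rightarrow> real" where
  "poisson_weight \<mu> n = exp (- \<mu>) * \<mu> ^ n / fact n"

lemma poisson_weight_nonneg: "0 \<le> \<mu> \<Longrightarrow> 0 \<le> poisson_weight \<mu> n"
  by (simp add: poisson_weight_def)

text \<open>Given the total n of two independent Poisson counts, the first is binomial with success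
  probability \<open>u / (u + w)\<close>; this is its mean, multiplied by the weight of the
  total.\<close>

lemma poisson_weight_split_mean:
  assumes "0 < u + w"
  shows "(\<Sum>k\<le>n. real k * (poisson_weight u k * poisson_weight w (n - k))) =
    real n * poisson_weight (u + w) n * (u / (u + w))"
proof (cases n)
  case (Suc m)
  have "fact n * (real k * (poisson_weight u k * poisson_weight w (n - k))) =
      exp (- (u + w)) * (real k * real (n choose k) * u ^ k * w ^ (n - k))" if "k \<le> n" for k
  proof -
    have "exp (- (u + w)) = exp (- u) * exp (- w)" by (simp flip: exp_add)
    moreover have "real (n choose k) = fact n / (fact k * fact (n - k))"
      using that by (rule binomial_fact)
    ultimately show ?thesis by (simp add: poisson_weight_def)
  qed
  then have "fact n * (\<Sum>k\<le>n. real k * (poisson_weight u k * poisson_weight w (n - k))) =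
      exp (- (u + w)) * (\<Sum>k\<le>n. real k * real (n choose k) * u ^ k * w ^ (n - k))"
    unfolding sum_distrib_left by (intro sum.cong refl) (simp only: atMost_iff)
  also have "(\<Sum>k\<le>n. real k * real (n choose k) * u ^ k * w ^ (n - k)) =
      (\<Sum>k\<le>m. real (Suc k) * real (n choose Suc k) * u ^ Suc k * w ^ (m - k))"
    unfolding Suc by (subst sum.atMost_Suc_shift) simp
  also have "\<dots> = (\<Sum>k\<le>m. real n * u * (real (m choose k) * u ^ k * w ^ (m - k)))"
  proof (intro sum.cong refl)
    fix k
    \<comment> \<open>Absorbing the factor k into the binomial coefficient reduces the sum to the
      binomial theorem with exponent \<open>n - 1\<close>.\<close>
    have "real (Suc k) * real (n choose Suc k) = real n * real (m choose k)"
      unfolding Suc of_nat_mult[symmetric] by (simp only: Suc_times_binomial)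
    then show "real (Suc k) * real (n choose Suc k) * u ^ Suc k * w ^ (m - k) = real n * u * (real (m choose k) * u ^ k * w ^ (m - k))"
      by (simp add: mult_ac)
  qed
  also have "\<dots> = real n * u * (u + w) ^ m"
    by (simp add: sum_distrib_left[symmetric] binomial_ring)
  finally show ?thesis using assms
    by (simp add: poisson_weight_def Suc nonzero_eq_divide_eq mult_ac del: fact_Suc of_nat_Suc)
qed simp

context prob_space
begin

lemma num_points_increment_prob:
  assumes P: "inhomogeneous_poisson_points M lam \<tau>" and st: "0 \<le> s" "s \<le> t"
  shows "prob {\<omega> \<in> space M. num_points \<tau> t \<omega> - num_points \<tau> s \<omega> = k} =
    poisson_weight (cumulative_intensity lam t - cumulative_intensity lam s) k"
proof (cases "s = t")
  case True
  then show ?thesis by (cases "k = 0") (auto simp: poisson_weight_def prob_space)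
next
  case False
  then show ?thesis
    using P st by (auto simp: inhomogeneous_poisson_points_def Let_def poisson_weight_def)
qed

lemma num_points_two_increments_prob:
  assumes P: "inhomogeneous_poisson_points M lam \<tau>" and bt: "0 \<le> b" "b \<le> t"
  shows "prob {\<omega> \<in> space M. num_points \<tau> b \<omega> - num_points \<tau> 0 \<omega> = k \<and> num_points \<tau> t \<omega> - num_points \<tau> b \<omega> = l} =
    poisson_weight (cumulative_intensity lam b) k *
    poisson_weight (cumulative_intensity lam t - cumulative_intensity lam b) l"
proof -
  \<comment> \<open>Independence of increments is given for infinite time sequences, so 0, b, t is
    continued by the constant t; only the first two increments are used.\<close>
  define u where "u k = (if k = 0 then 0 else if k = 1 then b else t)" for k :: nat
  define D where "D k \<omega> = num_points \<tau> (u (Suc k)) \<omega> - num_points \<tau> (u k) \<omega>" for k \<omega>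
  have "mono u" using bt by (auto simp: u_def mono_def)
  then have indep: "indep_vars (\<lambda>_. count_space UNIV) D UNIV"
    using P unfolding inhomogeneous_poisson_points_def D_def[abs_def]
    by (elim conjE) (drule spec[of _ u], simp add: u_def(1)[of 0])
  have "prob (\<Inter>j\<in>{0, 1}. D j -` {if j = 0 then k else l} \<inter> space M) =
      (\<Prod>j\<in>{0, 1}. prob (D j -` {if j = 0 then k else l} \<inter> space M))"
    by (rule indep_varsD[OF indep]) auto
  moreover have "(\<Inter>j\<in>{0, 1}. D j -` {if j = 0 then k else l} \<inter> space M) =
      {\<omega> \<in> space M. num_points \<tau> b \<omega> - num_points \<tau> 0 \<omega> = k \<and> num_points \<tau> t \<omega> - num_points \<tau> b \<omega> = l}"
    by (auto simp: D_def u_def)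
  moreover have "D 0 -` {k} \<inter> space M = {\<omega> \<in> space M. num_points \<tau> b \<omega> - num_points \<tau> 0 \<omega> = k}"
    "D 1 -` {l} \<inter> space M = {\<omega> \<in> space M. num_points \<tau> t \<omega> - num_points \<tau> b \<omega> = l}"
    by (auto simp: D_def u_def)
  ultimately show ?thesis
    using num_points_increment_prob[OF P order_refl bt(1)] num_points_increment_prob[OF P bt]
    by (simp add: cumulative_intensity_0)
qed

text \<open>On \<open>N(t) = n\<close> the count up to b has mean \<open>n * m(b) / m(t)\<close>. As
  a function of b this is n times the distribution function of V on \<open>[0, t]\<close>, which is
  how V enters.\<close>

lemma nn_integral_num_points_restricted:
  assumes P: "inhomogeneous_poisson_points M lam \<tau>" and bt: "0 \<le> b" "b \<le> t"
    and pos: "0 < cumulative_intensity lam t"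
  shows "(\<integral>\<^sup>+\<omega>. (if num_points \<tau> t \<omega> = n then of_nat (num_points \<tau> b \<omega>) else 0) \<partial>M) =
    ennreal (real n * poisson_weight (cumulative_intensity lam t) n *
      (cumulative_intensity lam b / cumulative_intensity lam t))"
proof -
  note [measurable] = measurable_Pair2[OF measurable_num_points[OF inhomogeneous_poisson_pointsD(1)[OF P]], simplified]
  let ?m = "cumulative_intensity lam"
  have m: "0 \<le> ?m b" "?m b \<le> ?m t"
    using cumulative_intensity_mono[OF inhomogeneous_poisson_pointsD(4)[OF P]] bt
      cumulative_intensity_mono[OF inhomogeneous_poisson_pointsD(4)[OF P], of 0 b]
    by (simp_all add: cumulative_intensity_0)
  let ?A = "\<lambda>k. {\<omega> \<in> space M. num_points \<tau> b \<omega> - num_points \<tau> 0 \<omega> = k \<and> num_points \<tau> t \<omega> - num_points \<tau> b \<omega> = n - k}"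
  have "(\<integral>\<^sup>+\<omega>. (if num_points \<tau> t \<omega> = n then of_nat (num_points \<tau> b \<omega>) else 0) \<partial>M) =
      (\<integral>\<^sup>+\<omega>. (\<Sum>k\<le>n. of_nat k * indicator (?A k) \<omega>) \<partial>M)"
  proof (rule nn_integral_cong_AE, use inhomogeneous_poisson_pointsD(2,3)[OF P] AE_space in eventually_elim)
    case (elim \<omega>)
    define N where "N s = num_points \<tau> s \<omega>" for s
    \<comment> \<open>Subtraction on naturals is truncated; with \<open>N b \<le> N t\<close>,
      increments k and \<open>n - k\<close> really mean \<open>N b = k\<close> and
      \<open>N t = n\<close>.\<close>
    have "N b \<le> N t"
      unfolding N_def num_points_def using elim(1) bt by (intro card_mono) auto
    have "(\<Sum>k\<le>n. of_nat k * indicator (?A k) \<omega>) = (\<Sum>k\<le>n. if k = N b then of_nat k * (if N t = n then 1 else 0 :: ennreal) else 0)"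
      using elim \<open>N b \<le> N t\<close> by (intro sum.cong) (auto simp: indicator_def N_def[symmetric])
    also have "\<dots> = of_nat (N b) * (if N t = n then 1 else 0)"
      using \<open>N b \<le> N t\<close> by (subst sum.delta) auto
    finally show ?case by (simp add: N_def indicator_def)
  qed
  also have "\<dots> = (\<Sum>k\<le>n. of_nat k * emeasure M (?A k))"
    by (subst nn_integral_sum) (auto simp: nn_integral_cmult)
  also have "\<dots> = (\<Sum>k\<le>n. ennreal (real k * (poisson_weight (?m b) k * poisson_weight (?m t - ?m b) (n - k))))"
    using m unfolding emeasure_eq_measure num_points_two_increments_prob[OF P bt]
    by (intro sum.cong refl) (simp add: ennreal_mult poisson_weight_nonneg ennreal_of_nat_eq_real_of_nat)
  also have "\<dots> = ennreal (\<Sum>k\<le>n. real k * (poisson_weight (?m b) k * poisson_weight (?m t - ?m b) (n - k)))"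
    using m by (intro sum_ennreal) (simp add: poisson_weight_nonneg)
  also have "\<dots> = ennreal (real n * poisson_weight (?m t) n * (?m b / ?m t))"
    using poisson_weight_split_mean[of "?m b" "?m t - ?m b" n] pos by simp
  finally show ?thesis .
qed

end

lemma power_le_fact_exp:
  fixes x :: real
  assumes "0 \<le> x"
  shows "x ^ k \<le> fact k * exp x"
proof -
  have "(\<Sum>n\<in>{k}. inverse (fact n) * x ^ n) \<le> (\<Sum>n. inverse (fact n) * x ^ n)"
    using assms by (intro sum_le_suminf summable_exp) auto
  then have "x ^ k / fact k \<le> exp x"
    by (simp add: exp_def divide_inverse mult.commute)
  then show ?thesis by (simp add: field_simps)
qed

text \<open>The weight at n divided by the weight at 1 is \<open>\<mu> ^ (n - 1) / n!\<close>, which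
  increases in \<mu>, so one series bounds all rates up to m. Comparing with the weight at 1 keeps
  the right order as \<mu> tends to 0, that is, for t near 0.\<close>

lemma poisson_weight_moment_bound:
  assumes m: "0 \<le> m"
  obtains B where "0 \<le> B" "\<And>\<mu>. 0 \<le> \<mu> \<Longrightarrow> \<mu> \<le> m \<Longrightarrow>
    (\<Sum>n. of_nat n ^ k * ennreal (real n * poisson_weight \<mu> n)) \<le> ennreal (B * poisson_weight \<mu> 1)"
proof -
  \<comment> \<open>At \<open>n = 0\<close> the factor \<open>n ^ Suc k\<close> vanishes, so the
    truncated exponent \<open>n - 1\<close> does no harm.\<close>
  define b where "b n = real n ^ Suc k * m ^ (n - 1) / fact n" for n
  have b0: "0 \<le> b n" for n using m by (simp add: b_def)
  have "summable (\<lambda>n. b (Suc n))"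
  \<comment> \<open>A power of n is at most a constant times \<open>exp n\<close>, so the terms are
    dominated by the exponential series at \<open>exp 1 * m\<close>.\<close>
  proof (rule summable_comparison_test'[of "\<lambda>n. fact (Suc k) * exp 1 * (inverse (fact n) * (exp 1 * m) ^ n)"])
    show "summable (\<lambda>n. fact (Suc k) * exp 1 * (inverse (fact n) * (exp 1 * m) ^ n))"
      by (intro summable_mult summable_exp)
    fix n
    have "real (Suc n) ^ Suc k \<le> fact (Suc k) * exp (real (Suc n))"
      by (intro power_le_fact_exp) simp
    also have "exp (real (Suc n)) = exp 1 * exp 1 ^ n"
      by (simp add: exp_of_nat_mult[symmetric] exp_add[symmetric])
    finally have le: "real (Suc n) ^ Suc k \<le> fact (Suc k) * (exp 1 * exp 1 ^ n)" .
    have "b (Suc n) = real (Suc n) ^ Suc k * m ^ n / fact (Suc n)"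
      by (simp add: b_def del: fact_Suc)
    also have "\<dots> \<le> real (Suc n) ^ Suc k * m ^ n / fact n"
      using m by (intro divide_left_mono fact_mono) (auto simp del: fact_Suc)
    also have "\<dots> \<le> fact (Suc k) * (exp 1 * exp 1 ^ n) * m ^ n / fact n"
      using m le by (intro divide_right_mono mult_right_mono) auto
    also have "\<dots> = fact (Suc k) * exp 1 * (inverse (fact n) * (exp 1 * m) ^ n)"
      by (simp add: power_mult_distrib divide_inverse mult_ac)
    finally show "norm (b (Suc n)) \<le> fact (Suc k) * exp 1 * (inverse (fact n) * (exp 1 * m) ^ n)"
      using b0[of "Suc n"] by simp
  qed
  then have b: "summable b" by (subst (asm) summable_Suc_iff)
  show thesis
  proof (rule that[of "suminf b"])
    show "0 \<le> suminf b" using b b0 by (rule suminf_nonneg)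
    fix \<mu> :: real assume \<mu>: "0 \<le> \<mu>" "\<mu> \<le> m"
    have "of_nat n ^ k * ennreal (real n * poisson_weight \<mu> n) \<le> ennreal (b n * poisson_weight \<mu> 1)" for n
    proof (cases n)
      case (Suc l)
      have "of_nat n ^ k * ennreal (real n * poisson_weight \<mu> n) = ennreal (real n ^ k * (real n * poisson_weight \<mu> n))"
        by (simp add: ennreal_mult poisson_weight_nonneg \<mu> ennreal_of_nat_eq_real_of_nat ennreal_power)
      also have "real n ^ k * (real n * poisson_weight \<mu> n) = real n ^ Suc k * \<mu> ^ l / fact n * poisson_weight \<mu> 1"
        by (simp add: poisson_weight_def Suc del: fact_Suc of_nat_Suc)
      also have "\<dots> \<le> b n * poisson_weight \<mu> 1"
        unfolding b_def using \<mu> by (intro mult_right_mono divide_right_mono mult_left_mono poisson_weight_nonneg)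
          (auto simp: Suc intro!: power_mono)
      finally show ?thesis by (simp add: ennreal_leI)
    qed simp
    then have "(\<Sum>n. of_nat n ^ k * ennreal (real n * poisson_weight \<mu> n)) \<le> (\<Sum>n. ennreal (b n * poisson_weight \<mu> 1))"
      by (intro suminf_le summableI)
    also have "\<dots> = ennreal (suminf b * poisson_weight \<mu> 1)"
      using b b0 \<mu> by (subst suminf_ennreal2) (auto intro!: mult_nonneg_nonneg poisson_weight_nonneg summable_mult2 simp: suminf_mult2[symmetric])
    finally show "(\<Sum>n. of_nat n ^ k * ennreal (real n * poisson_weight \<mu> n)) \<le> ennreal (suminf b * poisson_weight \<mu> 1)" .
  qed
qed

section \<open>Law of the points and of their marks given the number of points\<close>

context prob_space
begin

text \<open>Only a sum over all points is evaluated, so it suffices to compare two finite measures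
  on the line: the mean counting measure of the points on \<open>N(t) = n\<close>, and a multiple of
  the law of V. They agree on half-lines by the binomial mean.\<close>

lemma nn_integral_points_given_count:
  fixes g :: "real \<Rightarrow> ennreal"
  assumes P: "inhomogeneous_poisson_points M lam \<tau>" and t: "0 \<le> t"
    and pos: "0 < cumulative_intensity lam t"
    and V: "distributed M lborel V (\<lambda>s. ennreal (lam s / cumulative_intensity lam t * indicator {0..t} s))"
    and [measurable]: "g \<in> borel_measurable borel"
  shows "(\<integral>\<^sup>+\<omega>. (if num_points \<tau> t \<omega> = n then \<Sum>i=1..n. g (\<tau> i \<omega>) else 0) \<partial>M) =
    ennreal (real n * poisson_weight (cumulative_intensity lam t) n) * (\<integral>\<^sup>+\<omega>. g (V \<omega>) \<partial>M)"
proof -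
  let ?m = "cumulative_intensity lam" and ?N = "num_points \<tau>"
  note [measurable] = measurable_Pair2[OF measurable_num_points[OF inhomogeneous_poisson_pointsD(1)[OF P]], simplified]
  note \<tau>[measurable] = inhomogeneous_poisson_pointsD(1)[OF P]
  have V_meas[measurable]: "V \<in> borel_measurable M" using V by (simp add: distributed_def)
  have lam: "intensity_function lam" by (rule inhomogeneous_poisson_pointsD(4)[OF P])
  then have [measurable]: "lam \<in> borel_measurable borel" by (simp add: intensity_function_def)
  define c where "c = ennreal (real n * poisson_weight (?m t) n)"
  \<comment> \<open>D is M restricted to the event \<open>N(t) = n\<close>.\<close>
  define D where "D = density M (\<lambda>\<omega>. if ?N t \<omega> = n then 1 else 0 :: ennreal)"
  have [measurable_cong]: "sets D = sets M" by (simp add: D_def)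
  interpret D: finite_measure D
  proof
    have "emeasure D (space D) = (\<integral>\<^sup>+\<omega>. (if ?N t \<omega> = n then 1 else 0) * indicator (space M) \<omega> \<partial>M)"
      unfolding D_def space_density by (rule emeasure_density) measurable
    also have "\<dots> \<le> (\<integral>\<^sup>+\<omega>. 1 \<partial>M)" by (intro nn_integral_mono) (auto simp: indicator_def)
    also have "\<dots> < \<infinity>" by (simp add: emeasure_space_1)
    finally show "emeasure D (space D) \<noteq> \<infinity>" by simp
  qed
  interpret C: finite_measure "count_space {1..n}" by (rule finite_measure_count_space) simp
  interpret pair_sigma_finite "count_space {1..n}" D ..
  \<comment> \<open>M1 is the mean counting measure: index and sample point are drawn from the
    product of counting measure and D, then mapped to the instant.\<close>
  define M1 where "M1 = distr (count_space {1..n} \<Otimes>\<^sub>M D) borel (\<lambda>(i, \<omega>). \<tau> i \<omega>)"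
  define M2 where "M2 = density (distr M borel V) (\<lambda>_. c)"
  have \<tau>_pair[measurable]: "(\<lambda>(i, \<omega>). \<tau> i \<omega>) \<in> borel_measurable (count_space {1..n} \<Otimes>\<^sub>M D)"
    by (rule measurable_pair_measure_countable1) auto
  have M1: "(\<integral>\<^sup>+s. f s \<partial>M1) = (\<integral>\<^sup>+\<omega>. (if ?N t \<omega> = n then \<Sum>i=1..n. f (\<tau> i \<omega>) else 0) \<partial>M)"
    if [measurable]: "f \<in> borel_measurable borel" for f
  proof -
    have "(\<integral>\<^sup>+s. f s \<partial>M1) = (\<integral>\<^sup>+z. f (case z of (i, \<omega>) \<Rightarrow> \<tau> i \<omega>) \<partial>(count_space {1..n} \<Otimes>\<^sub>M D))"
      unfolding M1_def by (rule nn_integral_distr) measurable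
    also have "\<dots> = (\<integral>\<^sup>+i. \<integral>\<^sup>+\<omega>. f (\<tau> i \<omega>) \<partial>D \<partial>count_space {1..n})"
      using D.nn_integral_fst[OF measurable_compose[OF \<tau>_pair that]] by simp
    also have "\<dots> = (\<Sum>i=1..n. \<integral>\<^sup>+\<omega>. f (\<tau> i \<omega>) \<partial>D)"
      by (rule nn_integral_count_space_finite) simp
    also have "\<dots> = (\<Sum>i=1..n. \<integral>\<^sup>+\<omega>. (if ?N t \<omega> = n then 1 else 0) * f (\<tau> i \<omega>) \<partial>M)"
      unfolding D_def by (intro sum.cong refl nn_integral_density) auto
    also have "\<dots> = (\<integral>\<^sup>+\<omega>. (\<Sum>i=1..n. (if ?N t \<omega> = n then 1 else 0) * f (\<tau> i \<omega>)) \<partial>M)"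
      by (intro nn_integral_sum[symmetric]) auto
    also have "\<dots> = (\<integral>\<^sup>+\<omega>. (if ?N t \<omega> = n then \<Sum>i=1..n. f (\<tau> i \<omega>) else 0) \<partial>M)"
      by (intro nn_integral_cong) auto
    finally show ?thesis .
  qed
  \<comment> \<open>On \<open>N(t) = n\<close> the first n points are those up to t, so the ones up
    to b are counted by \<open>N (min b t)\<close>. This also covers \<open>b > t\<close>.\<close>
  have count: "(\<Sum>i=1..n. indicator {..b} (\<tau> i \<omega>) :: ennreal) = of_nat (?N (min b t) \<omega>)"
    if "?N t \<omega> = n" "(\<forall>i\<ge>1. 0 \<le> \<tau> i \<omega> \<and> \<tau> i \<omega> \<le> \<tau> (Suc i) \<omega>) \<and> (\<forall>t. finite {i. 1 \<le> i \<and> \<tau> i \<omega> \<le> t})" for b \<omega>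
  proof -
    have "{1..n} \<inter> {i. \<tau> i \<omega> \<le> b} = {i. 1 \<le> i \<and> \<tau> i \<omega> \<le> min b t}"
      using points_before_eq[of \<tau> \<omega> t, OF that(2)] that(1) by auto
    moreover have "(\<Sum>i=1..n. indicator {..b} (\<tau> i \<omega>) :: ennreal) = of_nat (card ({1..n} \<inter> {i. \<tau> i \<omega> \<le> b}))"
      by (simp add: indicator_def sum.If_cases of_bool_def)
    ultimately show ?thesis by (simp only: num_points_def)
  qed
  have "emeasure M1 {..b} = emeasure M2 {..b}" for b
  proof -
    have "emeasure M1 {..b} = (\<integral>\<^sup>+s. indicator {..b} s \<partial>M1)"
      by (simp add: M1_def)
    also have "\<dots> = (\<integral>\<^sup>+\<omega>. (if ?N t \<omega> = n then of_nat (?N (min b t) \<omega>) else 0) \<partial>M)"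
      unfolding M1[OF borel_measurable_indicator[OF borel_closed[OF closed_atMost]]]
      by (rule nn_integral_cong_AE, use inhomogeneous_poisson_pointsD(2)[OF P] in eventually_elim) (use count in auto)
    also have "\<dots> = c * emeasure M {\<omega> \<in> space M. V \<omega> \<le> b}"
    proof (cases "0 \<le> b")
      case True
      have "emeasure M {\<omega> \<in> space M. V \<omega> \<le> b} =
          (\<integral>\<^sup>+s. ennreal (lam s / ?m t * indicator {0..t} s) * indicator {..b} s \<partial>lborel)"
        using distributed_emeasure[OF V, of "{..b}"] by (simp add: vimage_def Int_def conj_commute)
      also have "\<dots> = (\<integral>\<^sup>+s. ennreal (1 / ?m t) * (ennreal (lam s) * indicator {0..min b t} s) \<partial>lborel)"
        using lam pos by (intro nn_integral_cong)
          (auto simp: indicator_def intensity_function_def ennreal_mult[symmetric] mult.commute)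
      also have "\<dots> = ennreal (1 / ?m t) * ennreal (?m (min b t))"
        using emeasure_intensity[OF lam, of "min b t"] True t by (subst nn_integral_cmult) auto
      also have "\<dots> = ennreal (?m (min b t) / ?m t)"
        using pos by (simp flip: ennreal_mult')
      finally have "emeasure M {\<omega> \<in> space M. V \<omega> \<le> b} = ennreal (?m (min b t) / ?m t)" .
      moreover have "(\<integral>\<^sup>+\<omega>. (if ?N t \<omega> = n then of_nat (?N (min b t) \<omega>) else 0) \<partial>M) =
          ennreal (real n * poisson_weight (?m t) n * (?m (min b t) / ?m t))"
        using True t by (intro nn_integral_num_points_restricted[OF P _ _ pos]) auto
      moreover have "c * ennreal (?m (min b t) / ?m t) = ennreal (real n * poisson_weight (?m t) n * (?m (min b t) / ?m t))"
        unfolding c_def by (rule ennreal_mult'[symmetric]) (use pos in \<open>simp add: poisson_weight_nonneg\<close>)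
      ultimately show ?thesis by (simp only:)
    next
      \<comment> \<open>For negative b both sides vanish: instants are nonnegative and the density
        of V lives on \<open>[0, t]\<close>.\<close>
      case False
      have "(\<integral>\<^sup>+\<omega>. (if ?N t \<omega> = n then of_nat (?N (min b t) \<omega>) else 0) \<partial>M) = (\<integral>\<^sup>+\<omega>. 0 \<partial>M)"
      proof (rule nn_integral_cong_AE, use inhomogeneous_poisson_pointsD(2)[OF P] in eventually_elim)
        case (elim \<omega>)
        then have "{i. 1 \<le> i \<and> \<tau> i \<omega> \<le> min b t} = {}" using False by force
        then have "?N (min b t) \<omega> = 0" unfolding num_points_def by (simp only: card.empty)
        then show ?case by simp
      qed
      moreover have "emeasure M {\<omega> \<in> space M. V \<omega> \<le> b} = (\<integral>\<^sup>+s. ennreal (lam s / ?m t * indicator {0..t} s) * indicator {..b} s \<partial>lborel)"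
        using distributed_emeasure[OF V, of "{..b}"] by (simp add: vimage_def Int_def conj_commute)
      moreover have "\<dots> = (\<integral>\<^sup>+(s :: real). 0 \<partial>lborel)"
        using False by (intro nn_integral_cong) (auto simp: indicator_def)
      ultimately show ?thesis by simp
    qed
    also have "\<dots> = emeasure M2 {..b}"
      by (simp add: M2_def emeasure_density nn_integral_cmult emeasure_distr vimage_def Int_def conj_commute)
    finally show ?thesis .
  qed
  moreover have "finite_borel_measure M1"
  proof (rule finite_borel_measure.intro)
    have "emeasure M1 (space M1) = emeasure (count_space {1..n} \<Otimes>\<^sub>M D) (space (count_space {1..n}) \<times> space D)"
      unfolding M1_def space_distr by (subst emeasure_distr[OF \<tau>_pair]) (simp_all add: space_pair_measure)
    also have "\<dots> = emeasure (count_space {1..n}) (space (count_space {1..n})) * emeasure D (space D)"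
      by (rule D.emeasure_pair_measure_Times) auto
    also have "\<dots> < \<infinity>"
      using D.emeasure_finite[of "space D"] by (simp add: ennreal_mult_eq_top_iff less_top[symmetric])
    finally show "finite_measure M1" by (intro finite_measureI) simp
  qed (unfold_locales, simp add: M1_def)
  moreover have "finite_borel_measure M2"
  proof (rule finite_borel_measure.intro)
    have "emeasure M2 (space M2) = c * emeasure M (space M)"
      by (simp add: M2_def emeasure_density nn_integral_cmult emeasure_distr)
    then show "finite_measure M2" by (intro finite_measureI) (simp add: emeasure_space_1 c_def)
  qed (unfold_locales, simp add: M2_def)
  ultimately have "M1 = M2"
    by (intro cdf_unique') (auto simp: cdf_def fun_eq_iff measure_def)
  then have "(\<integral>\<^sup>+s. g s \<partial>M1) = (\<integral>\<^sup>+s. g s \<partial>M2)" by simp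
  also have "\<dots> = c * (\<integral>\<^sup>+\<omega>. g (V \<omega>) \<partial>M)"
    by (simp add: M2_def nn_integral_density nn_integral_cmult nn_integral_distr)
  finally show ?thesis unfolding c_def M1[OF \<open>g \<in> borel_measurable borel\<close>] .
qed

text \<open>The event \<open>N(t) = n\<close> depends on the instants alone. Each mark can therefore
  be integrated out with the instants frozen, giving the same function G for every index by equality
  of laws. After the points are replaced by V, independence of \<open>h 0\<close> and V puts the
  mark back.\<close>

lemma nn_integral_marks_given_count:
  fixes g :: "(real \<Rightarrow> real \<Rightarrow> real) \<times> real \<Rightarrow> ennreal"
  assumes P: "inhomogeneous_poisson_points M lam \<tau>" and t: "0 \<le> t"
    and pos: "0 < cumulative_intensity lam t"
    and V: "distributed M lborel V (\<lambda>s. ennreal (lam s / cumulative_intensity lam t * indicator {0..t} s))"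
    and h[measurable]: "\<And>i. h i \<in> measurable M S" and h_distr: "\<And>i. distr M S (h i) = distr M S (h 0)"
    and h_\<tau>: "indep_elements M (\<Pi>\<^sub>M i\<in>{1..}. S) (\<lambda>\<omega>. \<lambda>i\<in>{1..}. h i \<omega>)
         (\<Pi>\<^sub>M i\<in>{1..}. borel) (\<lambda>\<omega>. \<lambda>i\<in>{1..}. \<tau> i \<omega>)"
    and h_V: "indep_elements M S (h 0) borel V"
    and [measurable]: "g \<in> borel_measurable (S \<Otimes>\<^sub>M borel)"
  shows "(\<integral>\<^sup>+\<omega>. (if num_points \<tau> t \<omega> = n then \<Sum>i=1..n. g (h i \<omega>, \<tau> i \<omega>) else 0) \<partial>M) =
    ennreal (real n * poisson_weight (cumulative_intensity lam t) n) * (\<integral>\<^sup>+\<omega>. g (h 0 \<omega>, V \<omega>) \<partial>M)"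
proof -
  note [measurable] = measurable_Pair2[OF measurable_num_points[OF inhomogeneous_poisson_pointsD(1)[OF P]], simplified]
  note \<tau>[measurable] = inhomogeneous_poisson_pointsD(1)[OF P]
  have [measurable]: "V \<in> borel_measurable M" using V by (simp add: distributed_def)
  define G where "G s = (\<integral>\<^sup>+\<omega>. g (h 0 \<omega>, s) \<partial>M)" for s
  have [measurable]: "G \<in> borel_measurable borel" unfolding G_def by measurable
  have G: "(\<integral>\<^sup>+\<omega>. g (h i \<omega>, s) \<partial>M) = G s" for i s
  proof -
    have eq: "(\<integral>\<^sup>+\<omega>. g (h i \<omega>, s) \<partial>M) = (\<integral>\<^sup>+f. g (f, s) \<partial>distr M S (h i))" for i
      by (subst nn_integral_distr) auto
    show ?thesis unfolding G_def eq[of i] eq[of 0] h_distr[of i] ..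
  qed
  have summand: "(\<integral>\<^sup>+\<omega>. (if num_points \<tau> t \<omega> = n then g (h i \<omega>, \<tau> i \<omega>) else 0) \<partial>M) =
      (\<integral>\<^sup>+\<omega>. (if num_points \<tau> t \<omega> = n then G (\<tau> i \<omega>) else 0) \<partial>M)" if i: "i \<in> {1..n}" for i
  proof -
    let ?H = "\<Pi>\<^sub>M i\<in>{1..}. S" and ?B = "\<Pi>\<^sub>M i\<in>{1::nat..}. borel :: real measure"
    \<comment> \<open>The count is recomputed from the coordinate sequence z, which makes the
      integrand a function of the two independent sequences.\<close>
    define f where "f = (\<lambda>(a :: nat \<Rightarrow> real \<Rightarrow> real \<Rightarrow> real, z :: nat \<Rightarrow> real).
      if num_points (\<lambda>j z. z j) t z = n then g (a i, z i) else 0)"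
    have [measurable]: "num_points (\<lambda>j z. z j) t \<in> ?B \<rightarrow>\<^sub>M count_space UNIV"
      using measurable_Pair2[OF measurable_num_points[of "\<lambda>j z. z j" ?B], of t] by simp
    have [measurable]: "(\<lambda>a. a i) \<in> ?H \<rightarrow>\<^sub>M S" "(\<lambda>z. z i) \<in> ?B \<rightarrow>\<^sub>M borel"
      using i by (auto intro: measurable_component_singleton)
    have f: "f \<in> borel_measurable (?H \<Otimes>\<^sub>M ?B)" unfolding f_def by measurable
    have N: "num_points (\<lambda>j z. z j) t (\<lambda>i\<in>{1..}. \<tau> i \<omega>) = num_points \<tau> t \<omega>" for \<omega>
      unfolding num_points_def by (intro arg_cong[where f=card]) auto
    have "f (\<lambda>i\<in>{1..}. h i \<omega>, \<lambda>i\<in>{1..}. \<tau> i \<omega>') = (if num_points \<tau> t \<omega>' = n then g (h i \<omega>, \<tau> i \<omega>') else 0)" for \<omega> \<omega>'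
      using i by (simp add: f_def N del: One_nat_def)
    with indep_elements_nn_integral[OF h_\<tau> f]
    have "(\<integral>\<^sup>+\<omega>. (if num_points \<tau> t \<omega> = n then g (h i \<omega>, \<tau> i \<omega>) else 0) \<partial>M) =
        (\<integral>\<^sup>+\<omega>'. \<integral>\<^sup>+\<omega>. (if num_points \<tau> t \<omega>' = n then g (h i \<omega>, \<tau> i \<omega>') else 0) \<partial>M \<partial>M)"
      by (simp only:)
    also have "\<dots> = (\<integral>\<^sup>+\<omega>. (if num_points \<tau> t \<omega> = n then G (\<tau> i \<omega>) else 0) \<partial>M)"
      by (intro nn_integral_cong) (simp add: G)
    finally show ?thesis .
  qed
  have "(\<integral>\<^sup>+\<omega>. (if num_points \<tau> t \<omega> = n then \<Sum>i=1..n. g (h i \<omega>, \<tau> i \<omega>) else 0) \<partial>M) =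
      (\<integral>\<^sup>+\<omega>. (\<Sum>i=1..n. if num_points \<tau> t \<omega> = n then g (h i \<omega>, \<tau> i \<omega>) else 0) \<partial>M)"
    by (intro nn_integral_cong) simp
  also have "\<dots> = (\<Sum>i=1..n. \<integral>\<^sup>+\<omega>. (if num_points \<tau> t \<omega> = n then G (\<tau> i \<omega>) else 0) \<partial>M)"
    by (subst nn_integral_sum) (auto simp: summand)
  also have "\<dots> = (\<integral>\<^sup>+\<omega>. (\<Sum>i=1..n. if num_points \<tau> t \<omega> = n then G (\<tau> i \<omega>) else 0) \<partial>M)"
    by (intro nn_integral_sum[symmetric]) auto
  also have "\<dots> = (\<integral>\<^sup>+\<omega>. (if num_points \<tau> t \<omega> = n then \<Sum>i=1..n. G (\<tau> i \<omega>) else 0) \<partial>M)"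
    by (intro nn_integral_cong) simp
  also have "\<dots> = ennreal (real n * poisson_weight (cumulative_intensity lam t) n) * (\<integral>\<^sup>+\<omega>. G (V \<omega>) \<partial>M)"
    by (rule nn_integral_points_given_count[OF P t pos V]) simp
  also have "(\<integral>\<^sup>+\<omega>. G (V \<omega>) \<partial>M) = (\<integral>\<^sup>+\<omega>. g (h 0 \<omega>, V \<omega>) \<partial>M)"
    unfolding G_def by (rule indep_elements_nn_integral[OF h_V, symmetric]) simp
  finally show ?thesis .
qed

text \<open>A Campbell formula with an additional weight in the total count, obtained by splitting
  over its value. The weight 1 gives means, and \<open>n ^ k\<close> gives the dominating
  function.\<close>

lemma nn_integral_weighted_marks:
  fixes g :: "(real \<Rightarrow> real \<Rightarrow> real) \<times> real \<Rightarrow> ennreal" and w :: "nat \<Rightarrow> ennreal"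
  assumes P: "inhomogeneous_poisson_points M lam \<tau>" and t: "0 \<le> t"
    and pos: "0 < cumulative_intensity lam t"
    and V: "distributed M lborel V (\<lambda>s. ennreal (lam s / cumulative_intensity lam t * indicator {0..t} s))"
    and h[measurable]: "\<And>i. h i \<in> measurable M S" and h_distr: "\<And>i. distr M S (h i) = distr M S (h 0)"
    and h_\<tau>: "indep_elements M (\<Pi>\<^sub>M i\<in>{1..}. S) (\<lambda>\<omega>. \<lambda>i\<in>{1..}. h i \<omega>)
         (\<Pi>\<^sub>M i\<in>{1..}. borel) (\<lambda>\<omega>. \<lambda>i\<in>{1..}. \<tau> i \<omega>)"
    and h_V: "indep_elements M S (h 0) borel V"
    and [measurable]: "g \<in> borel_measurable (S \<Otimes>\<^sub>M borel)"
  shows "(\<integral>\<^sup>+\<omega>. w (num_points \<tau> t \<omega>) * (\<Sum>i=1..num_points \<tau> t \<omega>. g (h i \<omega>, \<tau> i \<omega>)) \<partial>M) =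
    (\<Sum>n. w n * ennreal (real n * poisson_weight (cumulative_intensity lam t) n)) * (\<integral>\<^sup>+\<omega>. g (h 0 \<omega>, V \<omega>) \<partial>M)"
proof -
  note [measurable] = measurable_Pair2[OF measurable_num_points[OF inhomogeneous_poisson_pointsD(1)[OF P]], simplified]
  note \<tau>[measurable] = inhomogeneous_poisson_pointsD(1)[OF P]
  define F where "F n \<omega> = (if num_points \<tau> t \<omega> = n then \<Sum>i=1..n. g (h i \<omega>, \<tau> i \<omega>) else 0)" for n \<omega>
  have [measurable]: "F n \<in> borel_measurable M" for n
    unfolding F_def by measurable
  have "(\<integral>\<^sup>+\<omega>. w (num_points \<tau> t \<omega>) * (\<Sum>i=1..num_points \<tau> t \<omega>. g (h i \<omega>, \<tau> i \<omega>)) \<partial>M) =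
      (\<integral>\<^sup>+\<omega>. (\<Sum>n. w n * F n \<omega>) \<partial>M)"
  proof (intro nn_integral_cong)
    fix \<omega>
    have "(\<lambda>n. w n * F n \<omega>) = (\<lambda>n. if n = num_points \<tau> t \<omega> then w n * (\<Sum>i=1..n. g (h i \<omega>, \<tau> i \<omega>)) else 0)"
      by (auto simp: F_def)
    then show "w (num_points \<tau> t \<omega>) * (\<Sum>i=1..num_points \<tau> t \<omega>. g (h i \<omega>, \<tau> i \<omega>)) = (\<Sum>n. w n * F n \<omega>)"
      using sums_unique[OF sums_single[of "num_points \<tau> t \<omega>" "\<lambda>n. w n * (\<Sum>i=1..n. g (h i \<omega>, \<tau> i \<omega>))"]] by simp
  qed
  also have "\<dots> = (\<Sum>n. w n * (\<integral>\<^sup>+\<omega>. F n \<omega> \<partial>M))"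
    by (subst nn_integral_suminf) (auto simp: nn_integral_cmult)
  also have "\<dots> = (\<Sum>n. w n * ennreal (real n * poisson_weight (cumulative_intensity lam t) n) * (\<integral>\<^sup>+\<omega>. g (h 0 \<omega>, V \<omega>) \<partial>M))"
    unfolding F_def using nn_integral_marks_given_count[OF P t pos V h h_distr h_\<tau> h_V] by (simp add: mult.assoc)
  also have "\<dots> = (\<Sum>n. w n * ennreal (real n * poisson_weight (cumulative_intensity lam t) n)) * (\<integral>\<^sup>+\<omega>. g (h 0 \<omega>, V \<omega>) \<partial>M)"
    by (rule ennreal_suminf_multc)
  finally show ?thesis .
qed

end

section \<open>The shot noise process\<close>

text \<open>Two assumptions on the shocks take the form used later: equal laws become equal tails,
  and the supremum condition becomes a limit for each fixed pair. The latter suffices because frozen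
  marks involve finitely many shocks.\<close>

locale shot_noise_model = prob_space M for M :: "'a measure" +
  fixes X :: "nat \<Rightarrow> 'a \<Rightarrow> real" and S :: "(real \<Rightarrow> real \<Rightarrow> real) measure"
    and h :: "nat \<Rightarrow> 'a \<Rightarrow> real \<Rightarrow> real \<Rightarrow> real" and \<tau> :: "nat \<Rightarrow> 'a \<Rightarrow> real"
    and lam :: "real \<Rightarrow> real" and \<alpha> p :: real
  assumes poisson: "inhomogeneous_poisson_points M lam \<tau>"
    and exponents: "0 < \<alpha>" "\<alpha> < p"
    and X_measurable: "\<And>i. 1 \<le> i \<Longrightarrow> X i \<in> borel_measurable M"
    and X_nonneg: "\<And>i. 1 \<le> i \<Longrightarrow> AE \<omega> in M. 0 \<le> X i \<omega>"
    and X_tail_eq: "\<And>i x. 1 \<le> i \<Longrightarrow> tail M (X i) x = tail M (X 1) x"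
    and X_tail: "regularly_varying (tail M (X 1)) (- \<alpha>)"
    and X_pair: "\<And>i j. 1 \<le> i \<Longrightarrow> 1 \<le> j \<Longrightarrow> i \<noteq> j \<Longrightarrow>
      ((\<lambda>x. prob {\<omega> \<in> space M. X i \<omega> > x \<and> X j \<omega> > x} / tail M (X 1) x) \<longlongrightarrow> 0) at_top"
    and shock_functions: "iid_shock_functions M S h"
    and X_indep: "indep_elements M (\<Pi>\<^sub>M i\<in>{1..}. borel) (\<lambda>\<omega>. \<lambda>i\<in>{1..}. X i \<omega>)
         ((\<Pi>\<^sub>M i\<in>{1..}. S) \<Otimes>\<^sub>M (\<Pi>\<^sub>M i\<in>{1..}. borel))
         (\<lambda>\<omega>. (\<lambda>i\<in>{1..}. h i \<omega>, \<lambda>i\<in>{1..}. \<tau> i \<omega>))"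
    and h_\<tau>_indep: "indep_elements M (\<Pi>\<^sub>M i\<in>{1..}. S) (\<lambda>\<omega>. \<lambda>i\<in>{1..}. h i \<omega>)
         (\<Pi>\<^sub>M i\<in>{1..}. borel) (\<lambda>\<omega>. \<lambda>i\<in>{1..}. \<tau> i \<omega>)"
begin

abbreviation F :: "real \<Rightarrow> real" where "F \<equiv> tail M (X 1)"
abbreviation N :: "real \<Rightarrow> 'a \<Rightarrow> nat" where "N \<equiv> num_points \<tau>"
abbreviation Y :: "real \<Rightarrow> 'a \<Rightarrow> real" where "Y \<equiv> shot_noise X h \<tau>"

definition \<theta> :: "nat \<Rightarrow> real \<Rightarrow> 'a \<Rightarrow> real" where
  "\<theta> i t \<omega> = h i \<omega> t (\<tau> i \<omega>)"

text \<open>The marks and the count are frozen at \<omega>' while the shocks run over \<omega>; this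
  is the conditional tail of \<open>Y t\<close> given the marks.\<close>

definition cond_tail :: "real \<Rightarrow> 'a \<Rightarrow> real \<Rightarrow> real" where
  "cond_tail t \<omega>' y = prob {\<omega> \<in> space M. y < (\<Sum>i=1..N t \<omega>'. \<theta> i t \<omega>' * X i \<omega>)}"

text \<open>Extended-valued, since finiteness is only established for almost every t. The exponent
  \<alpha> yields the limit, the exponent p the domination.\<close>

definition mark_moment :: "real \<Rightarrow> real \<Rightarrow> ennreal" where
  "mark_moment q t = (\<integral>\<^sup>+\<omega>. (\<Sum>i=1..N t \<omega>. ennreal (\<theta> i t \<omega> powr q)) \<partial>M)"

definition mean_count :: "real \<Rightarrow> ennreal" where
  "mean_count t = (\<integral>\<^sup>+\<omega>. of_nat (N t \<omega>) \<partial>M)"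

lemma evaluation_measurable: "measurable_function_space S" and h_measurable: "\<And>i. h i \<in> measurable M S"
  and h_distr: "\<And>i. distr M S (h i) = distr M S (h 0)"
  and h_nonneg: "\<And>i. AE \<omega> in M. \<forall>t\<ge>0. \<forall>s\<ge>0. 0 \<le> h i \<omega> t s"
  using shock_functions by (auto simp: iid_shock_functions_def)

lemmas \<tau>_measurable = inhomogeneous_poisson_pointsD(1)[OF poisson]

declare X_measurable[measurable] h_measurable[measurable] \<tau>_measurable[measurable]

lemmas N_measurable_pair = measurable_num_points[OF \<tau>_measurable]
lemmas N_measurable[measurable] = measurable_Pair2[OF N_measurable_pair, simplified]

lemma \<theta>_measurable_pair: "1 \<le> i \<Longrightarrow> (\<lambda>(t, \<omega>). \<theta> i t \<omega>) \<in> borel_measurable (borel \<Otimes>\<^sub>M M)"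
  unfolding \<theta>_def by (intro measurable_random_function[OF evaluation_measurable] h_measurable \<tau>_measurable)

lemma Y_measurable_pair: "(\<lambda>(t, \<omega>). Y t \<omega>) \<in> borel_measurable (borel \<Otimes>\<^sub>M M)"
  by (intro measurable_shot_noise[OF evaluation_measurable] h_measurable \<tau>_measurable X_measurable)

lemma Y_measurable[measurable]: "Y t \<in> borel_measurable M"
  using measurable_Pair2[OF Y_measurable_pair, of t] by simp

lemma sum_\<theta>_measurable_pair:
  fixes f :: "real \<Rightarrow> 'b :: {second_countable_topology, topological_comm_monoid_add}"
  assumes [measurable]: "f \<in> borel_measurable borel"
  shows "(\<lambda>(t, \<omega>). \<Sum>i=1..N t \<omega>. f (\<theta> i t \<omega>)) \<in> borel_measurable (borel \<Otimes>\<^sub>M M)"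
proof (rule measurable_sum_num_points[OF \<tau>_measurable])
  fix i :: nat assume "1 \<le> i"
  from measurable_compose[OF \<theta>_measurable_pair[OF this] assms]
  show "(\<lambda>(t, \<omega>). f (\<theta> i t \<omega>)) \<in> borel_measurable (borel \<Otimes>\<^sub>M M)"
    by (simp add: case_prod_unfold)
qed

lemma sum_\<theta>_measurable:
  fixes f :: "real \<Rightarrow> 'b :: {second_countable_topology, topological_comm_monoid_add}"
  assumes "f \<in> borel_measurable borel"
  shows "(\<lambda>\<omega>. \<Sum>i=1..N t \<omega>. f (\<theta> i t \<omega>)) \<in> borel_measurable M"
  using measurable_Pair2[OF sum_\<theta>_measurable_pair[OF assms], of t] by simp

lemma mark_moment_measurable[measurable]: "mark_moment q \<in> borel_measurable borel"
  unfolding mark_moment_def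
  by (rule borel_measurable_nn_integral[OF sum_\<theta>_measurable_pair[of "\<lambda>x. ennreal (x powr q)"]]) measurable

lemma mean_count_measurable[measurable]: "mean_count \<in> borel_measurable borel"
  unfolding mean_count_def
  by (rule borel_measurable_nn_integral) (use measurable_compose[OF N_measurable_pair, where g="of_nat :: nat \<Rightarrow> ennreal" and L=borel] in \<open>simp add: case_prod_unfold\<close>)

lemma \<theta>_nonneg: 
  assumes "0 \<le> t"
  shows "AE \<omega> in M. \<forall>i\<ge>1. 0 \<le> \<theta> i t \<omega>"
proof -
  have "AE \<omega> in M. \<forall>i. \<forall>t\<ge>0. \<forall>s\<ge>0. 0 \<le> h i \<omega> t s"
    using h_nonneg by (simp add: AE_all_countable)
  with inhomogeneous_poisson_pointsD(2)[OF poisson] show ?thesis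
    by eventually_elim (use assms in \<open>auto simp: \<theta>_def\<close>)
qed

lemma cond_tail_measurable[measurable]: "(\<lambda>\<omega>'. cond_tail t \<omega>' y) \<in> borel_measurable M"
proof -
  \<comment> \<open>Z is the shot noise on the product of two copies of the space, with marks from
    the first and shocks from the second; the conditional tail is the measure of a section.\<close>
  define Z where "Z = shot_noise (\<lambda>i u. X i (snd u)) (\<lambda>i u. h i (fst u)) (\<lambda>i u. \<tau> i (fst u)) t"
  have [measurable]: "Z \<in> borel_measurable (M \<Otimes>\<^sub>M M)"
    unfolding Z_def
    using measurable_Pair2[OF measurable_shot_noise[OF evaluation_measurable, of "\<lambda>i u. X i (snd u)" "M \<Otimes>\<^sub>M M" "\<lambda>i u. h i (fst u)" "\<lambda>i u. \<tau> i (fst u)"], of t]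
    by simp
  have Z: "Z (\<omega>', \<omega>) = (\<Sum>i=1..N t \<omega>'. \<theta> i t \<omega>' * X i \<omega>)" for \<omega>' \<omega>
    unfolding Z_def shot_noise_def by (auto simp: \<theta>_def num_points_def mult.commute intro!: sum.cong)
  have "(\<lambda>\<omega>'. emeasure M (Pair \<omega>' -` {u \<in> space (M \<Otimes>\<^sub>M M). y < Z u})) \<in> borel_measurable M"
    by (intro measurable_emeasure_Pair) measurable
  then have "(\<lambda>\<omega>'. enn2real (emeasure M (Pair \<omega>' -` {u \<in> space (M \<Otimes>\<^sub>M M). y < Z u}))) \<in> borel_measurable M"
    by measurable
  moreover have "enn2real (emeasure M (Pair \<omega>' -` {u \<in> space (M \<Otimes>\<^sub>M M). y < Z u})) = cond_tail t \<omega>' y" if "\<omega>' \<in> space M" for \<omega>'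
    unfolding cond_tail_def measure_def
    using that by (intro arg_cong[where f=enn2real] arg_cong[where f="emeasure M"]) (auto simp: space_pair_measure Z)
  ultimately show ?thesis by (simp cong: measurable_cong)
qed

lemma emeasure_Y_eq: "emeasure M {\<omega> \<in> space M. y < Y t \<omega>} = (\<integral>\<^sup>+\<omega>'. ennreal (cond_tail t \<omega>' y) \<partial>M)"
proof -
  let ?A = "\<Pi>\<^sub>M i\<in>{1::nat..}. borel :: real measure" and ?H = "\<Pi>\<^sub>M i\<in>{1::nat..}. S"
  \<comment> \<open>The same shot noise as a functional of the sequences of shocks, functions and
    instants, to which the independence hypothesis applies.\<close>
  define Z where "Z = shot_noise (\<lambda>i (u :: (nat \<Rightarrow> real) \<times> (nat \<Rightarrow> real \<Rightarrow> real \<Rightarrow> real) \<times> (nat \<Rightarrow> real)). fst u i)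
    (\<lambda>i u. fst (snd u) i) (\<lambda>i u. snd (snd u) i) t"
  have component: "(\<lambda>a. a i) \<in> measurable ?A borel" "(\<lambda>a. a i) \<in> measurable ?H S" if "1 \<le> i" for i
    using that by (auto intro: measurable_component_singleton)
  have [measurable]: "Z \<in> borel_measurable (?A \<Otimes>\<^sub>M (?H \<Otimes>\<^sub>M ?A))"
  proof -
    have "(\<lambda>(t, u). shot_noise (\<lambda>i u. fst u i) (\<lambda>i u. fst (snd u) i) (\<lambda>i u. snd (snd u) i) t u)
        \<in> borel_measurable (borel \<Otimes>\<^sub>M (?A \<Otimes>\<^sub>M (?H \<Otimes>\<^sub>M ?A)))"
      by (intro measurable_shot_noise[OF evaluation_measurable])
         (auto intro!: measurable_compose[OF _ component(1)] measurable_compose[OF _ component(2)]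
           simp del: One_nat_def)
    from measurable_Pair2[OF this, of t] show ?thesis by (simp add: Z_def)
  qed
  define f where "f u = (if y < Z u then 1 else 0 :: ennreal)" for u
  have f: "f \<in> borel_measurable (?A \<Otimes>\<^sub>M (?H \<Otimes>\<^sub>M ?A))" unfolding f_def by measurable
  have Z: "Z (\<lambda>i\<in>{1..}. X i \<omega>, \<lambda>i\<in>{1..}. h i \<omega>', \<lambda>i\<in>{1..}. \<tau> i \<omega>') = (\<Sum>i=1..N t \<omega>'. X i \<omega> * \<theta> i t \<omega>')" for \<omega> \<omega>'
  proof -
    have "num_points (\<lambda>i (u :: (nat \<Rightarrow> real) \<times> (nat \<Rightarrow> real \<Rightarrow> real \<Rightarrow> real) \<times> (nat \<Rightarrow> real)). snd (snd u) i) t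
        (\<lambda>i\<in>{1..}. X i \<omega>, \<lambda>i\<in>{1..}. h i \<omega>', \<lambda>i\<in>{1..}. \<tau> i \<omega>') = N t \<omega>'"
      unfolding num_points_def by (intro arg_cong[where f=card]) auto
    then show ?thesis unfolding Z_def shot_noise_def \<theta>_def by (intro sum.cong) (auto simp del: One_nat_def)
  qed
  have "emeasure M {\<omega> \<in> space M. y < Y t \<omega>} = (\<integral>\<^sup>+\<omega>. indicator {\<omega> \<in> space M. y < Y t \<omega>} \<omega> \<partial>M)"
    by simp
  also have "\<dots> = (\<integral>\<^sup>+\<omega>. f (\<lambda>i\<in>{1..}. X i \<omega>, \<lambda>i\<in>{1..}. h i \<omega>, \<lambda>i\<in>{1..}. \<tau> i \<omega>) \<partial>M)"
    unfolding f_def Z by (intro nn_integral_cong) (auto simp: shot_noise_def \<theta>_def)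
  also have "\<dots> = (\<integral>\<^sup>+\<omega>'. \<integral>\<^sup>+\<omega>. f (\<lambda>i\<in>{1..}. X i \<omega>, \<lambda>i\<in>{1..}. h i \<omega>', \<lambda>i\<in>{1..}. \<tau> i \<omega>') \<partial>M \<partial>M)"
    by (rule indep_elements_nn_integral[OF X_indep f])
  also have "\<dots> = (\<integral>\<^sup>+\<omega>'. ennreal (cond_tail t \<omega>' y) \<partial>M)"
  proof (intro nn_integral_cong)
    fix \<omega>'
    have "(\<integral>\<^sup>+\<omega>. f (\<lambda>i\<in>{1..}. X i \<omega>, \<lambda>i\<in>{1..}. h i \<omega>', \<lambda>i\<in>{1..}. \<tau> i \<omega>') \<partial>M) =
        (\<integral>\<^sup>+\<omega>. indicator {\<omega> \<in> space M. y < (\<Sum>i=1..N t \<omega>'. \<theta> i t \<omega>' * X i \<omega>)} \<omega> \<partial>M)"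
      unfolding f_def Z by (intro nn_integral_cong) (auto simp: mult.commute)
    also have "\<dots> = ennreal (cond_tail t \<omega>' y)"
      unfolding cond_tail_def emeasure_eq_measure[symmetric]
      by (intro nn_integral_indicator) measurable
    finally show "(\<integral>\<^sup>+\<omega>. f (\<lambda>i\<in>{1..}. X i \<omega>, \<lambda>i\<in>{1..}. h i \<omega>', \<lambda>i\<in>{1..}. \<tau> i \<omega>') \<partial>M) = ennreal (cond_tail t \<omega>' y)" .
  qed
  finally show ?thesis .
qed

lemma prob_Y_eq: "prob {\<omega> \<in> space M. y < Y t \<omega>} = (\<integral>\<omega>'. cond_tail t \<omega>' y \<partial>M)"
proof -
  have "(\<integral>\<omega>'. cond_tail t \<omega>' y \<partial>M) = enn2real (\<integral>\<^sup>+\<omega>'. ennreal (cond_tail t \<omega>' y) \<partial>M)"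
    by (rule integral_eq_nn_integral[OF cond_tail_measurable]) (simp add: cond_tail_def)
  then show ?thesis by (simp add: emeasure_Y_eq[symmetric] measure_def)
qed

lemma cond_tail_limit:
  assumes "0 \<le> t"
  shows "AE \<omega>' in M. ((\<lambda>y. cond_tail t \<omega>' y / F y) \<longlongrightarrow> (\<Sum>i=1..N t \<omega>'. \<theta> i t \<omega>' powr \<alpha>)) at_top"
  using \<theta>_nonneg[OF assms]
proof eventually_elim
  case (elim \<omega>')
  then show ?case
    unfolding cond_tail_def
    by (intro weighted_sum_tail_limit X_tail X_pair) (auto intro: X_nonneg X_tail_eq simp del: One_nat_def)
qed

text \<open>The constants are common to all t and \<omega>', so the same bound serves both
  applications of dominated convergence.\<close>

lemma cond_tail_bound:
  obtains C x0 where "0 < C" "0 < x0" "\<And>y. x0 \<le> y \<Longrightarrow> 0 < F y"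
    "\<And>t. 0 \<le> t \<Longrightarrow> AE \<omega>' in M. \<forall>y\<ge>x0. cond_tail t \<omega>' y \<le>
        C * F y * (real (N t \<omega>') ^ nat \<lceil>p\<rceil> * (\<Sum>i=1..N t \<omega>'. 1 + \<theta> i t \<omega>' powr p))"
proof -
  obtain C x0 where C: "0 < C" "0 < x0" "\<And>y. x0 \<le> y \<Longrightarrow> 0 < F y"
    "\<And>y n c. x0 \<le> y \<Longrightarrow> (\<And>i. i \<in> {1..n} \<Longrightarrow> 0 \<le> c i) \<Longrightarrow>
      prob {\<omega> \<in> space M. y < (\<Sum>i=1..n. c i * X i \<omega>)} \<le>
        C * F y * (real n ^ nat \<lceil>p\<rceil> * (\<Sum>i=1..n. 1 + c i powr p))"
    using weighted_sum_tail_bound[of X F \<alpha> p, OF X_measurable X_tail_eq X_tail] exponents by auto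
  show thesis
  proof (rule that[OF C(1-3)])
    fix t :: real assume "0 \<le> t"
    from \<theta>_nonneg[OF this] show "AE \<omega>' in M. \<forall>y\<ge>x0. cond_tail t \<omega>' y \<le>
        C * F y * (real (N t \<omega>') ^ nat \<lceil>p\<rceil> * (\<Sum>i=1..N t \<omega>'. 1 + \<theta> i t \<omega>' powr p))"
      unfolding cond_tail_def by eventually_elim (intro allI impI C(4), auto)
  qed
qed

end

section \<open>From equivalent tails to equivalent integrated tails\<close>

text \<open>Far out, f lies between \<open>(K - e) * g\<close> and \<open>(K + e) * g\<close>, and
  integration preserves this. Integrability of f is a conclusion because a Bochner integral that
  does not exist is 0 by default.\<close>

lemma set_integral_ratio_limit:
  fixes f g :: "real \<Rightarrow> real"
  assumes [measurable]: "f \<in> borel_measurable borel" "g \<in> borel_measurable borel"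
    and pos: "\<And>y. x0 \<le> y \<Longrightarrow> 0 < g y" and int: "set_integrable lborel {x0..} g"
    and lim: "((\<lambda>y. f y / g y) \<longlongrightarrow> K) at_top"
  shows "\<forall>\<^sub>F x in at_top. set_integrable lborel {x..} f"
    and "((\<lambda>x. (LINT y:{x..}|lborel. f y) / (LINT y:{x..}|lborel. g y)) \<longlongrightarrow> K) at_top"
proof -
  have g: "set_integrable lborel {x..} g" if "x0 \<le> x" for x
    using int by (rule set_integrable_subset) (use that in auto)
  have g_pos: "0 < (LINT y:{x..}|lborel. g y)" if x: "x0 \<le> x" for x
  proof -
    have nonneg: "0 \<le> indicator {x..} y * g y" for y
      using pos[of y] x by (auto simp: indicator_def)
    have "(\<integral>y. indicator {x..} y * g y \<partial>lborel) \<noteq> 0"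
    proof
      assume "(\<integral>y. indicator {x..} y * g y \<partial>lborel) = 0"
      then have "AE y in lborel. indicator {x..} y * g y = 0"
        using g[OF x] nonneg by (subst (asm) integral_nonneg_eq_0_iff_AE) (auto simp: set_integrable_def)
      \<comment> \<open>The interval is a witness of positive Lebesgue measure on which g is
        positive.\<close>
      then have "AE y in lborel. y \<notin> {x..x + 1}"
      proof eventually_elim
        case (elim y)
        then show ?case using pos[of y] x by (auto simp: indicator_def split: if_splits)
      qed
      then have "{x..x + 1} \<in> null_sets lborel" by (subst AE_iff_null_sets) auto
      then show False by (auto simp: null_sets_def)
    qed
    moreover have "0 \<le> (\<integral>y. indicator {x..} y * g y \<partial>lborel)" using nonneg by (intro Bochner_Integration.integral_nonneg) auto
    ultimately show ?thesis by (simp add: set_lebesgue_integral_def)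
  qed
  have close: "\<forall>\<^sub>F x in at_top. set_integrable lborel {x..} f \<and>
      \<bar>(LINT y:{x..}|lborel. f y) / (LINT y:{x..}|lborel. g y) - K\<bar> \<le> e" if e: "0 < e" for e
  proof -
    from tendstoD[OF lim e] obtain x1 where x1: "\<And>y. x1 \<le> y \<Longrightarrow> \<bar>f y / g y - K\<bar> < e"
      by (auto simp: eventually_at_top_linorder dist_real_def)
    show ?thesis
      using eventually_ge_at_top[of "max x0 x1"]
    proof eventually_elim
      case (elim x)
      have bound: "(K - e) * g y \<le> f y" "f y \<le> (K + e) * g y" if "x \<le> y" for y
        using x1[of y] pos[of y] elim that by (auto simp: abs_less_iff field_simps)
      have f: "set_integrable lborel {x..} f"
        unfolding set_integrable_def
      proof (rule Bochner_Integration.integrable_bound)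
        show "integrable lborel (\<lambda>y. (\<bar>K\<bar> + e) * (indicator {x..} y *\<^sub>R g y))"
          using g[of x] elim unfolding set_integrable_def by (intro integrable_mult_right) auto
        have "\<bar>f y\<bar> \<le> (\<bar>K\<bar> + e) * g y" if "x \<le> y" for y
        proof -
          have "(K + e) * g y \<le> (\<bar>K\<bar> + e) * g y" "- ((\<bar>K\<bar> + e) * g y) \<le> (K - e) * g y"
            using pos[of y] that elim by (auto simp flip: mult_minus_left intro!: mult_right_mono)
          then show ?thesis using bound[OF that] by linarith
        qed
        moreover have "\<bar>g y\<bar> = g y" if "x \<le> y" for y
          using pos[of y] that elim by simp
        ultimately show "AE y in lborel. norm (indicator {x..} y *\<^sub>R f y) \<le> norm ((\<bar>K\<bar> + e) * (indicator {x..} y *\<^sub>R g y))"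
          using e by (intro AE_I2) (auto simp: indicator_def abs_mult)
      qed measurable
      let ?G = "LINT y:{x..}|lborel. g y"
      have "(LINT y:{x..}|lborel. f y) \<le> (LINT y:{x..}|lborel. (K + e) * g y)"
        using f g[of x] elim bound by (intro set_integral_mono set_integrable_mult_right) auto
      moreover have "(LINT y:{x..}|lborel. (K - e) * g y) \<le> (LINT y:{x..}|lborel. f y)"
        using f g[of x] elim bound by (intro set_integral_mono set_integrable_mult_right) auto
      ultimately have "(K - e) * ?G \<le> (LINT y:{x..}|lborel. f y)" "(LINT y:{x..}|lborel. f y) \<le> (K + e) * ?G"
        by simp_all
      then show ?case using f g_pos[of x] elim by (auto simp: abs_le_iff field_simps)
    qed
  qed
  show "\<forall>\<^sub>F x in at_top. set_integrable lborel {x..} f"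
    using close[OF zero_less_one] by eventually_elim auto
  show "((\<lambda>x. (LINT y:{x..}|lborel. f y) / (LINT y:{x..}|lborel. g y)) \<longlongrightarrow> K) at_top"
  proof (rule tendstoI)
    fix e :: real assume "0 < e"
    from close[of "e / 2"] this show "\<forall>\<^sub>F x in at_top. dist ((LINT y:{x..}|lborel. f y) / (LINT y:{x..}|lborel. g y)) K < e"
      by (auto elim!: eventually_mono simp: dist_real_def)
  qed
qed

text \<open>The integrand of \<open>order_p\<close> equals \<open>mark_moment p t\<close>, so the
  assumption is exactly integrability in t of the p-th mark moment.\<close>

locale shot_noise_horizon = shot_noise_model +
  fixes T :: real and V :: "real \<Rightarrow> 'a \<Rightarrow> real"
  assumes X_integrable: "integrable M (X 1)"
    and V_density: "\<And>t. 0 < t \<Longrightarrow> t \<le> T \<Longrightarrow> distributed M lborel (V t)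
         (\<lambda>s. ennreal (lam s / cumulative_intensity lam t * indicator {0..t} s))"
    and V_indep: "\<And>t. 0 < t \<Longrightarrow> t \<le> T \<Longrightarrow> indep_elements M S (h 0) borel (V t)"
    and order_p: "(\<integral>\<^sup>+t\<in>{0<..T}. mean_count t * (\<integral>\<^sup>+\<omega>. ennreal (h 0 \<omega> t (V t \<omega>) powr p) \<partial>M) \<partial>lborel) < \<infinity>"
begin

abbreviation m :: "real \<Rightarrow> real" where "m \<equiv> cumulative_intensity lam"

lemma m_mono: "0 \<le> s \<Longrightarrow> s \<le> t \<Longrightarrow> m s \<le> m t"
  by (rule cumulative_intensity_mono[OF inhomogeneous_poisson_pointsD(4)[OF poisson]])

text \<open>If $m(t) = 0$, the density of \<open>V t\<close> would vanish identically, since $x / 0 = 0$.\<close>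

lemma m_pos:
  assumes t: "0 < t" "t \<le> T"
  shows "0 < m t"
proof (rule ccontr)
  assume "\<not> 0 < m t"
  then have "m t = 0" using m_mono[of 0 t] t by (simp add: cumulative_intensity_0)
  then show False
    using distributed_emeasure[OF V_density[OF t], of UNIV] by (simp add: emeasure_space_1)
qed

context
  fixes t assumes t: "0 < t" "t \<le> T"
begin

lemma weighted_mark_sum:
  fixes g :: "real \<Rightarrow> ennreal"
  assumes [measurable]: "g \<in> borel_measurable borel"
  shows "(\<integral>\<^sup>+\<omega>. w (N t \<omega>) * (\<Sum>i=1..N t \<omega>. g (\<theta> i t \<omega>)) \<partial>M) =
    (\<Sum>n. w n * ennreal (real n * poisson_weight (m t) n)) * (\<integral>\<^sup>+\<omega>. g (h 0 \<omega> t (V t \<omega>)) \<partial>M)"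
proof -
  have "(\<lambda>(f, s). (f, t, s)) \<in> S \<Otimes>\<^sub>M borel \<rightarrow>\<^sub>M S \<Otimes>\<^sub>M borel \<Otimes>\<^sub>M borel" by measurable
  from measurable_compose[OF this evaluation_measurable[unfolded measurable_function_space_def]]
  have [measurable]: "(\<lambda>(f, s). f t s) \<in> borel_measurable (S \<Otimes>\<^sub>M borel)"
    by (simp add: case_prod_unfold)
  have "(\<lambda>u. g (case u of (f, s) \<Rightarrow> f t s)) \<in> borel_measurable (S \<Otimes>\<^sub>M borel)" by measurable
  from nn_integral_weighted_marks[OF poisson _ m_pos[OF t] V_density[OF t] h_measurable h_distr h_\<tau>_indep V_indep[OF t] this, of w]
  show ?thesis using t by (simp add: \<theta>_def)
qed

lemma mean_count_eq: "mean_count t = (\<Sum>n. ennreal (real n * poisson_weight (m t) n))"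
  using weighted_mark_sum[of "\<lambda>_. 1" "\<lambda>_. 1"] by (simp add: mean_count_def emeasure_space_1)

lemma mark_moment_eq: "mark_moment q t = mean_count t * (\<integral>\<^sup>+\<omega>. ennreal (h 0 \<omega> t (V t \<omega>) powr q) \<partial>M)"
  using weighted_mark_sum[of "\<lambda>x. ennreal (x powr q)" "\<lambda>_. 1"] by (simp add: mean_count_eq mark_moment_def)

lemma poisson_weight_le_mean_count: "ennreal (poisson_weight (m t) 1) \<le> mean_count t"
  using sum_le_suminf[OF summableI, of "{1}" "\<lambda>n. ennreal (real n * poisson_weight (m t) n)"]
  by (simp add: mean_count_eq)

lemma weighted_mark_sum_p:
  "(\<integral>\<^sup>+\<omega>. ennreal (real (N t \<omega>) ^ k * (\<Sum>i=1..N t \<omega>. 1 + \<theta> i t \<omega> powr p)) \<partial>M) =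
    (\<Sum>n. of_nat n ^ k * ennreal (real n * poisson_weight (m t) n)) *
    (1 + (\<integral>\<^sup>+\<omega>. ennreal (h 0 \<omega> t (V t \<omega>) powr p) \<partial>M))"
proof -
  have [measurable]: "(\<lambda>\<omega>. h 0 \<omega> t (V t \<omega>)) \<in> borel_measurable M"
    using measurable_Pair2[OF measurable_random_function[OF evaluation_measurable h_measurable, of "V t"], of t] V_density[OF t]
    by (simp add: distributed_def)
  have "(\<integral>\<^sup>+\<omega>. ennreal (real (N t \<omega>) ^ k * (\<Sum>i=1..N t \<omega>. 1 + \<theta> i t \<omega> powr p)) \<partial>M) =
      (\<integral>\<^sup>+\<omega>. of_nat (N t \<omega>) ^ k * (\<Sum>i=1..N t \<omega>. ennreal (1 + \<theta> i t \<omega> powr p)) \<partial>M)"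
    by (intro nn_integral_cong) (simp add: ennreal_mult sum_nonneg sum_ennreal ennreal_of_nat_eq_real_of_nat ennreal_power del: ennreal_plus)
  also have "\<dots> = (\<Sum>n. of_nat n ^ k * ennreal (real n * poisson_weight (m t) n)) *
      (\<integral>\<^sup>+\<omega>. ennreal (1 + h 0 \<omega> t (V t \<omega>) powr p) \<partial>M)"
    by (rule weighted_mark_sum[of "\<lambda>x. ennreal (1 + x powr p)" "\<lambda>n. of_nat n ^ k"]) measurable
  also have "(\<integral>\<^sup>+\<omega>. ennreal (1 + h 0 \<omega> t (V t \<omega>) powr p) \<partial>M) = 1 + (\<integral>\<^sup>+\<omega>. ennreal (h 0 \<omega> t (V t \<omega>) powr p) \<partial>M)"
    by (simp add: nn_integral_add emeasure_space_1)
  finally show ?thesis .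
qed

end

text \<open>The moments of the Poisson count are at most a constant times
  \<open>P(N(t) = 1)\<close>, and this is the term \<open>n = 1\<close> of the series for
  \<open>mean_count t\<close>. Thus the factor \<open>N ^ k\<close> costs only B, uniformly in
  t.\<close>

lemma weighted_mark_sum_bound:
  obtains B where "0 \<le> B" "\<And>t. 0 < t \<Longrightarrow> t \<le> T \<Longrightarrow>
    (\<integral>\<^sup>+\<omega>. ennreal (real (N t \<omega>) ^ k * (\<Sum>i=1..N t \<omega>. 1 + \<theta> i t \<omega> powr p)) \<partial>M) \<le>
      ennreal B * (mean_count t + mark_moment p t)"
proof (cases "0 \<le> T")
  case True
  have m0: "0 \<le> m s" if "0 \<le> s" for s
    using m_mono[of 0 s] that by (simp add: cumulative_intensity_0)
  obtain B where B: "0 \<le> B" "\<And>\<mu>. 0 \<le> \<mu> \<Longrightarrow> \<mu> \<le> m T \<Longrightarrow>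
      (\<Sum>n. of_nat n ^ k * ennreal (real n * poisson_weight \<mu> n)) \<le> ennreal (B * poisson_weight \<mu> 1)"
    using poisson_weight_moment_bound[OF m0[OF True], of k] by blast
  show thesis
  proof (rule that[OF B(1)])
    fix t assume t: "0 < t" "t \<le> T"
    have "(\<Sum>n. of_nat n ^ k * ennreal (real n * poisson_weight (m t) n)) \<le> ennreal (B * poisson_weight (m t) 1)"
      using t m_mono[of t T] m0[of t] by (intro B(2)) auto
    also have "\<dots> = ennreal B * ennreal (poisson_weight (m t) 1)"
      using B(1) by (rule ennreal_mult')
    also have "\<dots> \<le> ennreal B * mean_count t"
      using poisson_weight_le_mean_count[OF t] by (intro mult_left_mono) auto
    finally show "(\<integral>\<^sup>+\<omega>. ennreal (real (N t \<omega>) ^ k * (\<Sum>i=1..N t \<omega>. 1 + \<theta> i t \<omega> powr p)) \<partial>M) \<le>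
        ennreal B * (mean_count t + mark_moment p t)"
      unfolding weighted_mark_sum_p[OF t] mark_moment_eq[OF t]
      by (auto simp: distrib_left mult.assoc[symmetric] intro!: add_mono mult_right_mono)
  qed
qed (use that[of 0] in auto)

section \<open>Integration over the time horizon\<close>

text \<open>Lebesgue measure on \<open>(0, T]\<close>. Time 0 is left out because \<open>V t\<close>
  is specified for positive t only.\<close>

definition \<Lambda> :: "real measure" where
  "\<Lambda> = density lborel (\<lambda>t. ennreal (indicator {0<..T} t))"

lemma sets_\<Lambda>[measurable_cong, simp]: "sets \<Lambda> = sets borel"
  by (simp add: \<Lambda>_def)

lemma space_\<Lambda>[simp]: "space \<Lambda> = UNIV"
  by (simp add: \<Lambda>_def)

lemma AE_\<Lambda>: 
  assumes [measurable]: "Measurable.pred borel P"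
  shows "(AE t in \<Lambda>. P t) \<longleftrightarrow> (AE t in lborel. 0 < t \<longrightarrow> t \<le> T \<longrightarrow> P t)"
  unfolding \<Lambda>_def by (subst AE_density) (auto simp: indicator_def)

lemma AE_\<Lambda>_range: "AE t in \<Lambda>. 0 < t \<and> t \<le> T"
  by (subst AE_\<Lambda>) auto

lemma nn_integral_\<Lambda>: "f \<in> borel_measurable borel \<Longrightarrow> (\<integral>\<^sup>+t. f t \<partial>\<Lambda>) = (\<integral>\<^sup>+t\<in>{0<..T}. f t \<partial>lborel)"
  unfolding \<Lambda>_def by (subst nn_integral_density) (auto simp: mult.commute intro!: nn_integral_cong split: split_indicator)

sublocale \<Lambda>: finite_measure \<Lambda>
proof
  have "emeasure \<Lambda> (space \<Lambda>) = (\<integral>\<^sup>+t. 1 \<partial>\<Lambda>)" by simp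
  also have "\<dots> < \<infinity>" by (subst nn_integral_\<Lambda>, simp, cases "0 \<le> T") auto
  finally show "emeasure \<Lambda> (space \<Lambda>) \<noteq> \<infinity>" by simp
qed

lemma horizon_moment_finite: "(\<integral>\<^sup>+t. mean_count t + mark_moment p t \<partial>\<Lambda>) < \<infinity>"
proof -
  \<comment> \<open>With \<open>k = 0\<close> the moment bound controls the mean count itself. The
    maximum with 0 is there because the locale leaves the sign of T open.\<close>
  obtain B where B: "0 \<le> B" "\<And>\<mu>. 0 \<le> \<mu> \<Longrightarrow> \<mu> \<le> max 0 (m T) \<Longrightarrow>
      (\<Sum>n. of_nat n ^ 0 * ennreal (real n * poisson_weight \<mu> n)) \<le> ennreal (B * poisson_weight \<mu> 1)"
    using poisson_weight_moment_bound[of "max 0 (m T)" 0] by auto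
  have "AE t in \<Lambda>. mean_count t \<le> ennreal B"
    using AE_\<Lambda>_range
  proof eventually_elim
    case (elim t)
    have "mean_count t \<le> ennreal (B * poisson_weight (m t) 1)"
      using B(2)[of "m t"] elim m_pos[of t] m_mono[of t T] by (simp add: mean_count_eq)
    also have "\<dots> \<le> ennreal B"
    proof (intro ennreal_leI)
      have "m t \<le> exp (m t)" using exp_ge_add_one_self[of "m t"] by linarith
      then have "poisson_weight (m t) 1 \<le> 1" by (simp add: poisson_weight_def exp_minus field_simps)
      then show "B * poisson_weight (m t) 1 \<le> B" using B(1) mult_left_mono[of "poisson_weight (m t) 1" 1 B] by simp
    qed
    finally show ?case .
  qed
  then have "(\<integral>\<^sup>+t. mean_count t \<partial>\<Lambda>) \<le> (\<integral>\<^sup>+t. ennreal B \<partial>\<Lambda>)" by (rule nn_integral_mono_AE)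
  also have "\<dots> < \<infinity>" using \<Lambda>.emeasure_finite[of UNIV] by (simp add: ennreal_mult_eq_top_iff less_top[symmetric])
  finally have 1: "(\<integral>\<^sup>+t. mean_count t \<partial>\<Lambda>) < \<infinity>" .
  have "(\<integral>\<^sup>+t. mark_moment p t \<partial>\<Lambda>) = (\<integral>\<^sup>+t\<in>{0<..T}. mark_moment p t \<partial>lborel)"
    by (rule nn_integral_\<Lambda>) measurable
  also have "\<dots> = (\<integral>\<^sup>+t\<in>{0<..T}. mean_count t * (\<integral>\<^sup>+\<omega>. ennreal (h 0 \<omega> t (V t \<omega>) powr p) \<partial>M) \<partial>lborel)"
    by (intro nn_integral_cong) (auto simp: mark_moment_eq split: split_indicator)
  finally have 2: "(\<integral>\<^sup>+t. mark_moment p t \<partial>\<Lambda>) < \<infinity>" using order_p by simp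
  show ?thesis using 1 2 by (subst nn_integral_add) auto
qed

text \<open>The moments at a single t may be infinite on a null set, which is why statements at
  fixed t carry their finiteness as a premise.\<close>

lemma AE_moment_finite: "AE t in \<Lambda>. 0 < t \<and> t \<le> T \<and> mean_count t + mark_moment p t < \<infinity>"
proof -
  have "AE t in \<Lambda>. mean_count t + mark_moment p t \<noteq> \<infinity>"
    using horizon_moment_finite by (intro nn_integral_PInf_AE) auto
  with AE_\<Lambda>_range show ?thesis by eventually_elim (auto simp: less_top)
qed

lemma mark_moment_\<alpha>_le: "mark_moment \<alpha> t \<le> mean_count t + mark_moment p t"
proof -
  \<comment> \<open>The split is on the sign of \<open>ln x\<close>, so the inequality holds for
    every real x and no nonnegativity of the marks has to be carried along.\<close>
  have le: "x powr \<alpha> \<le> 1 + x powr p" for x :: real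
  proof (cases "ln x \<le> 0")
    case True
    then have "\<alpha> * ln x \<le> 0" using exponents by (simp add: mult_nonneg_nonpos)
    then have "x powr \<alpha> \<le> 1" by (simp add: powr_def)
    then show ?thesis by (simp add: add_increasing2)
  next
    case False
    then have "\<alpha> * ln x \<le> p * ln x" using exponents by (intro mult_right_mono) auto
    then have "x powr \<alpha> \<le> x powr p" by (simp add: powr_def)
    then show ?thesis by simp
  qed
  have "ennreal (x powr \<alpha>) \<le> 1 + ennreal (x powr p)" for x :: real
    using ennreal_leI[OF le[of x]] by simp
  then have "(\<Sum>i=1..N t \<omega>. ennreal (\<theta> i t \<omega> powr \<alpha>)) \<le> (\<Sum>i=1..N t \<omega>. 1 + ennreal (\<theta> i t \<omega> powr p))" for \<omega>
    by (intro sum_mono)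
  then have "mark_moment \<alpha> t \<le> (\<integral>\<^sup>+\<omega>. of_nat (N t \<omega>) + (\<Sum>i=1..N t \<omega>. ennreal (\<theta> i t \<omega> powr p)) \<partial>M)"
    unfolding mark_moment_def by (intro nn_integral_mono) (simp add: sum.distrib)
  also have "\<dots> = mean_count t + mark_moment p t"
    unfolding mean_count_def mark_moment_def
    by (rule nn_integral_add[OF _ sum_\<theta>_measurable[of "\<lambda>x. ennreal (x powr p)"]]) measurable
  finally show ?thesis .
qed

text \<open>Dominated convergence over the marks at fixed t. The same majorant, integrated, gives
  the bound that dominates in t afterwards; its constant K is \<open>C * B\<close>.\<close>

lemma shot_noise_tail:
  obtains K x0 where "0 \<le> K" "\<And>y. x0 \<le> y \<Longrightarrow> 0 < F y"
    "\<And>t y. 0 < t \<Longrightarrow> t \<le> T \<Longrightarrow> mean_count t + mark_moment p t < \<infinity> \<Longrightarrow> x0 \<le> y \<Longrightarrow>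
      prob {\<omega> \<in> space M. y < Y t \<omega>} \<le> K * F y * enn2real (mean_count t + mark_moment p t)"
    "\<And>t. 0 < t \<Longrightarrow> t \<le> T \<Longrightarrow> mean_count t + mark_moment p t < \<infinity> \<Longrightarrow>
      ((\<lambda>y. prob {\<omega> \<in> space M. y < Y t \<omega>} / F y) \<longlongrightarrow> enn2real (mark_moment \<alpha> t)) at_top"
proof -
  define k where "k = nat \<lceil>p\<rceil>"
  define D where "D t \<omega> = real (N t \<omega>) ^ k * (\<Sum>i=1..N t \<omega>. 1 + \<theta> i t \<omega> powr p)" for t \<omega>
  obtain B where B: "0 \<le> B" "\<And>t. 0 < t \<Longrightarrow> t \<le> T \<Longrightarrow>
      (\<integral>\<^sup>+\<omega>. ennreal (D t \<omega>) \<partial>M) \<le> ennreal B * (mean_count t + mark_moment p t)"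
    by (rule weighted_mark_sum_bound[where k=k, folded D_def]) (rule that)
  obtain C x0 where C: "0 < C" "\<And>y. x0 \<le> y \<Longrightarrow> 0 < F y"
    "\<And>t. 0 \<le> t \<Longrightarrow> AE \<omega> in M. \<forall>y\<ge>x0. cond_tail t \<omega> y \<le> C * F y * D t \<omega>"
    by (rule cond_tail_bound[folded k_def, folded D_def]) (rule that)
  have D0: "0 \<le> D t \<omega>" for t \<omega> by (auto simp: D_def intro!: mult_nonneg_nonneg sum_nonneg)
  have [measurable]: "(\<lambda>\<omega>. \<Sum>i=1..N t \<omega>. \<theta> i t \<omega> powr \<alpha>) \<in> borel_measurable M" for t
    by (rule sum_\<theta>_measurable[of "\<lambda>x. x powr \<alpha>"]) measurable
  have [measurable]: "D t \<in> borel_measurable M" for t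
    unfolding D_def by (intro borel_measurable_times sum_\<theta>_measurable) measurable
  have D_int: "integrable M (D t)" "(\<integral>\<omega>. D t \<omega> \<partial>M) \<le> B * enn2real (mean_count t + mark_moment p t)"
    if t: "0 < t" "t \<le> T" "mean_count t + mark_moment p t < \<infinity>" for t
  proof -
    have fin: "ennreal B * (mean_count t + mark_moment p t) < \<infinity>"
      using t(3) by (auto simp: ennreal_mult_less_top)
    then have "(\<integral>\<^sup>+\<omega>. ennreal (D t \<omega>) \<partial>M) < \<infinity>" by (rule le_less_trans[OF B(2)[OF t(1,2)]])
    then show "integrable M (D t)" using D0 by (intro integrableI_nonneg) auto
    have "(\<integral>\<omega>. D t \<omega> \<partial>M) = enn2real (\<integral>\<^sup>+\<omega>. ennreal (D t \<omega>) \<partial>M)"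
      using D0 by (intro integral_eq_nn_integral) auto
    also have "\<dots> \<le> enn2real (ennreal B * (mean_count t + mark_moment p t))"
      using B(2)[OF t(1,2)] fin by (intro enn2real_mono) auto
    finally show "(\<integral>\<omega>. D t \<omega> \<partial>M) \<le> B * enn2real (mean_count t + mark_moment p t)"
      using B(1) by (simp add: enn2real_mult)
  qed
  have cond_int: "integrable M (\<lambda>\<omega>. cond_tail t \<omega> y)" for t y
    by (rule integrable_const_bound[where B=1, OF _ cond_tail_measurable]) (simp add: cond_tail_def)
  show thesis
  proof (rule that[of "C * B" x0])
    fix t y :: real assume t: "0 < t" "t \<le> T" "mean_count t + mark_moment p t < \<infinity>" and y: "x0 \<le> y"
    have "prob {\<omega> \<in> space M. y < Y t \<omega>} \<le> (\<integral>\<omega>. C * F y * D t \<omega> \<partial>M)"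
      unfolding prob_Y_eq
    proof (rule integral_mono_AE)
      show "AE \<omega> in M. cond_tail t \<omega> y \<le> C * F y * D t \<omega>"
        using C(3)[of t] t y by auto
    qed (use D_int(1)[OF t] cond_int in auto)
    also have "\<dots> = C * F y * (\<integral>\<omega>. D t \<omega> \<partial>M)" by simp
    also have "\<dots> \<le> C * F y * (B * enn2real (mean_count t + mark_moment p t))"
      using C y D_int(2)[OF t] by (intro mult_left_mono) (auto simp: less_imp_le)
    finally show "prob {\<omega> \<in> space M. y < Y t \<omega>} \<le> C * B * F y * enn2real (mean_count t + mark_moment p t)"
      by (simp add: mult_ac)
  next
    fix t assume t: "0 < t" "t \<le> T" "mean_count t + mark_moment p t < \<infinity>"
    have "((\<lambda>y. \<integral>\<omega>. cond_tail t \<omega> y / F y \<partial>M) \<longlongrightarrow> (\<integral>\<omega>. (\<Sum>i=1..N t \<omega>. \<theta> i t \<omega> powr \<alpha>) \<partial>M)) at_top"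
    proof (rule integral_dominated_convergence_at_top)
      show "AE \<omega> in M. ((\<lambda>y. cond_tail t \<omega> y / F y) \<longlongrightarrow> (\<Sum>i=1..N t \<omega>. \<theta> i t \<omega> powr \<alpha>)) at_top"
        using t by (intro cond_tail_limit) auto
      show "\<forall>\<^sub>F y in at_top. AE \<omega> in M. norm (cond_tail t \<omega> y / F y) \<le> C * D t \<omega>"
        using eventually_ge_at_top[of x0]
      proof eventually_elim
        case (elim y)
        have "AE \<omega> in M. \<forall>y\<ge>x0. cond_tail t \<omega> y \<le> C * F y * D t \<omega>" using C(3) t by auto
        then show ?case
        proof eventually_elim
          case (elim \<omega>)
          have "cond_tail t \<omega> y \<le> C * D t \<omega> * F y" using elim \<open>x0 \<le> y\<close> by (auto simp: mult_ac)
          then have "cond_tail t \<omega> y / F y \<le> C * D t \<omega>"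
            using C(2)[OF \<open>x0 \<le> y\<close>] by (subst pos_divide_le_eq) auto
          then show ?case using C(2)[OF \<open>x0 \<le> y\<close>] by (simp add: cond_tail_def)
        qed
      qed
      show "integrable M (\<lambda>\<omega>. C * D t \<omega>)" using D_int(1)[OF t] by simp
    qed measurable
    moreover have "(\<integral>\<omega>. (\<Sum>i=1..N t \<omega>. \<theta> i t \<omega> powr \<alpha>) \<partial>M) = enn2real (mark_moment \<alpha> t)"
    proof -
      have "(\<integral>\<omega>. (\<Sum>i=1..N t \<omega>. \<theta> i t \<omega> powr \<alpha>) \<partial>M) = enn2real (\<integral>\<^sup>+\<omega>. ennreal (\<Sum>i=1..N t \<omega>. \<theta> i t \<omega> powr \<alpha>) \<partial>M)"
        by (rule integral_eq_nn_integral) (measurable, simp add: sum_nonneg)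
      then show ?thesis by (simp add: mark_moment_def sum_ennreal)
    qed
    ultimately show "((\<lambda>y. prob {\<omega> \<in> space M. y < Y t \<omega>} / F y) \<longlongrightarrow> enn2real (mark_moment \<alpha> t)) at_top"
      unfolding prob_Y_eq by simp
  qed (use B C in auto)
qed

text \<open>The tail of \<open>Y\<close> under the product of time measure and M. The integrated
  expected severity is its integral over \<open>[x, \<infinity>)\<close>, by Tonelli.\<close>

definition horizon_tail :: "real \<Rightarrow> real" where
  "horizon_tail y = (\<integral>t. prob {\<omega> \<in> space M. y < Y t \<omega>} \<partial>\<Lambda>)"

definition limit_constant :: real where
  "limit_constant = (\<integral>t. enn2real (mark_moment \<alpha> t) \<partial>\<Lambda>)"

lemma prob_Y_measurable[measurable]: "(\<lambda>t. prob {\<omega> \<in> space M. y < Y t \<omega>}) \<in> borel_measurable borel"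
proof -
  note [measurable] = Y_measurable_pair
  let ?A = "{u \<in> space (borel \<Otimes>\<^sub>M M). y < (case u of (t, \<omega>) \<Rightarrow> Y t \<omega>)}"
  have "(\<lambda>t. emeasure M (Pair t -` ?A)) \<in> borel_measurable borel"
    by (intro measurable_emeasure_Pair) measurable
  then have "(\<lambda>t. enn2real (emeasure M (Pair t -` ?A))) \<in> borel_measurable borel" by measurable
  moreover have "Pair t -` ?A = {\<omega> \<in> space M. y < Y t \<omega>}" for t
    by (auto simp: space_pair_measure)
  ultimately show ?thesis by (simp add: measure_def)
qed

lemma prob_Y_integrable: "integrable \<Lambda> (\<lambda>t. prob {\<omega> \<in> space M. y < Y t \<omega>})"
  by (rule \<Lambda>.integrable_const_bound[where B=1]) auto

lemma horizon_tail_nonneg: "0 \<le> horizon_tail y"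
  unfolding horizon_tail_def by (intro Bochner_Integration.integral_nonneg) auto

lemma horizon_tail_measurable[measurable]: "horizon_tail \<in> borel_measurable borel"
proof -
  have "mono (\<lambda>y. - horizon_tail y)"
    unfolding horizon_tail_def
    by (intro monoI le_imp_neg_le integral_mono prob_Y_integrable finite_measure_mono) auto
  then have "(\<lambda>y. - (- horizon_tail y)) \<in> borel_measurable borel"
    by (intro borel_measurable_uminus borel_measurable_mono)
  then show ?thesis by simp
qed

lemma moment_integrable:
  "integrable \<Lambda> (\<lambda>t. enn2real (mean_count t + mark_moment p t))"
proof (rule integrableI_nonneg)
  have "(\<integral>\<^sup>+t. ennreal (enn2real (mean_count t + mark_moment p t)) \<partial>\<Lambda>) \<le> (\<integral>\<^sup>+t. mean_count t + mark_moment p t \<partial>\<Lambda>)"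
    by (intro nn_integral_mono) (simp add: ennreal_enn2real_if)
  then show "(\<integral>\<^sup>+t. ennreal (enn2real (mean_count t + mark_moment p t)) \<partial>\<Lambda>) < \<infinity>"
    using horizon_moment_finite by (rule le_less_trans)
qed auto

lemma horizon_tail_limit: "((\<lambda>y. horizon_tail y / F y) \<longlongrightarrow> limit_constant) at_top"
proof -
  obtain K x0 where K: "0 \<le> K" "\<And>y. x0 \<le> y \<Longrightarrow> 0 < F y"
    "\<And>t y. 0 < t \<Longrightarrow> t \<le> T \<Longrightarrow> mean_count t + mark_moment p t < \<infinity> \<Longrightarrow> x0 \<le> y \<Longrightarrow>
      prob {\<omega> \<in> space M. y < Y t \<omega>} \<le> K * F y * enn2real (mean_count t + mark_moment p t)"
    "\<And>t. 0 < t \<Longrightarrow> t \<le> T \<Longrightarrow> mean_count t + mark_moment p t < \<infinity> \<Longrightarrow>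
      ((\<lambda>y. prob {\<omega> \<in> space M. y < Y t \<omega>} / F y) \<longlongrightarrow> enn2real (mark_moment \<alpha> t)) at_top"
    by (rule shot_noise_tail) (rule that)
  have "((\<lambda>y. \<integral>t. prob {\<omega> \<in> space M. y < Y t \<omega>} / F y \<partial>\<Lambda>) \<longlongrightarrow> limit_constant) at_top"
    unfolding limit_constant_def
  proof (rule integral_dominated_convergence_at_top)
    show "AE t in \<Lambda>. ((\<lambda>y. prob {\<omega> \<in> space M. y < Y t \<omega>} / F y) \<longlongrightarrow> enn2real (mark_moment \<alpha> t)) at_top"
      using AE_moment_finite by eventually_elim (intro K(4); simp)
    show "\<forall>\<^sub>F y in at_top. AE t in \<Lambda>. norm (prob {\<omega> \<in> space M. y < Y t \<omega>} / F y) \<le> K * enn2real (mean_count t + mark_moment p t)"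
      using eventually_ge_at_top[of x0]
    proof eventually_elim
      case (elim y)
      show ?case
        using AE_moment_finite
      proof eventually_elim
        case (elim t)
        have "prob {\<omega> \<in> space M. y < Y t \<omega>} \<le> K * enn2real (mean_count t + mark_moment p t) * F y"
          using K(3)[of t y] elim \<open>x0 \<le> y\<close> by (simp add: mult_ac)
        then have "prob {\<omega> \<in> space M. y < Y t \<omega>} / F y \<le> K * enn2real (mean_count t + mark_moment p t)"
          using K(2)[OF \<open>x0 \<le> y\<close>] by (subst pos_divide_le_eq) auto
        then show ?case using K(2)[OF \<open>x0 \<le> y\<close>] by simp
      qed
    qed
    show "integrable \<Lambda> (\<lambda>t. K * enn2real (mean_count t + mark_moment p t))"
      using moment_integrable by simp
  qed measurable
  then show ?thesis by (simp add: horizon_tail_def)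
qed

text \<open>Equivalence to the zero function requires exact vanishing. A zero constant makes all
  marks before t vanish almost surely for almost every t, hence \<open>Y t = 0\<close>.\<close>

lemma horizon_tail_zero:
  assumes "limit_constant = 0" "0 \<le> y"
  shows "horizon_tail y = 0"
proof -
  have "integrable \<Lambda> (\<lambda>t. enn2real (mark_moment \<alpha> t))"
  proof (rule Bochner_Integration.integrable_bound[OF moment_integrable])
    show "AE t in \<Lambda>. norm (enn2real (mark_moment \<alpha> t)) \<le> norm (enn2real (mean_count t + mark_moment p t))"
      using AE_moment_finite by eventually_elim (auto intro!: enn2real_mono mark_moment_\<alpha>_le)
  qed measurable
  then have "AE t in \<Lambda>. enn2real (mark_moment \<alpha> t) = 0"
    using assms(1) unfolding limit_constant_def by (subst (asm) integral_nonneg_eq_0_iff_AE) auto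
  then have "AE t in \<Lambda>. prob {\<omega> \<in> space M. y < Y t \<omega>} = 0"
    using AE_moment_finite
  proof eventually_elim
    case (elim t)
    \<comment> \<open>Finiteness comes first because \<open>enn2real\<close> sends infinity to 0 as
      well.\<close>
    have "mark_moment \<alpha> t < \<infinity>" using mark_moment_\<alpha>_le[of t] elim(2) by (auto intro: le_less_trans)
    then have "mark_moment \<alpha> t = 0" using elim(1) by (auto simp: enn2real_eq_0_iff)
    moreover have "(\<lambda>\<omega>. \<Sum>i=1..N t \<omega>. ennreal (\<theta> i t \<omega> powr \<alpha>)) \<in> borel_measurable M"
      by (rule sum_\<theta>_measurable[of "\<lambda>x. ennreal (x powr \<alpha>)"]) measurable
    ultimately have "AE \<omega> in M. (\<Sum>i=1..N t \<omega>. ennreal (\<theta> i t \<omega> powr \<alpha>)) = 0"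
      unfolding mark_moment_def by (simp only: nn_integral_0_iff_AE)
    then have "AE \<omega> in M. \<omega> \<notin> {\<omega> \<in> space M. y < Y t \<omega>}"
    proof eventually_elim
      case (elim \<omega>)
      have "\<theta> i t \<omega> = 0" if "i \<in> {1..N t \<omega>}" for i
      proof -
        have "ennreal (\<theta> i t \<omega> powr \<alpha>) = 0"
          using elim that unfolding sum_eq_0_iff[OF finite_atLeastAtMost] by blast
        then show ?thesis by (simp add: ennreal_eq_0_iff)
      qed
      then have "Y t \<omega> = 0" unfolding shot_noise_def \<theta>_def by (intro sum.neutral) auto
      then show ?case using assms(2) by simp
    qed
    then show ?case by (intro prob_eq_0[THEN iffD2]) auto
  qed
  then show ?thesis unfolding horizon_tail_def by (rule integral_eq_zero_AE)
qed

lemma emeasure_horizon: 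
  "emeasure (\<Lambda> \<Otimes>\<^sub>M M) {u \<in> space (\<Lambda> \<Otimes>\<^sub>M M). y < (case u of (t, \<omega>) \<Rightarrow> Y t \<omega>)} = ennreal (horizon_tail y)"
proof -
  note [measurable] = Y_measurable_pair
  let ?A = "{u \<in> space (\<Lambda> \<Otimes>\<^sub>M M). y < (case u of (t, \<omega>) \<Rightarrow> Y t \<omega>)}"
  have "emeasure (\<Lambda> \<Otimes>\<^sub>M M) ?A = (\<integral>\<^sup>+t. emeasure M (Pair t -` ?A) \<partial>\<Lambda>)"
    by (rule emeasure_pair_measure_alt) measurable
  also have "\<dots> = (\<integral>\<^sup>+t. ennreal (prob {\<omega> \<in> space M. y < Y t \<omega>}) \<partial>\<Lambda>)"
    unfolding emeasure_eq_measure[symmetric]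
    by (intro nn_integral_cong arg_cong[where f="emeasure M"]) (auto simp: space_pair_measure)
  also have "\<dots> = ennreal (horizon_tail y)"
    unfolding horizon_tail_def by (intro nn_integral_eq_integral prob_Y_integrable) auto
  finally show ?thesis .
qed

lemma integral_\<Lambda>:
  fixes f :: "real \<Rightarrow> real"
  assumes [measurable]: "f \<in> borel_measurable borel"
  shows "(\<integral>t. f t \<partial>\<Lambda>) = (LINT t:{0<..T}|lborel. f t)"
  unfolding \<Lambda>_def set_lebesgue_integral_def by (subst integral_density) auto

text \<open>Tonelli is carried out with nonnegative integrals. The integrability premise makes the
  result finite, so passing back to Bochner integrals hits no default value.\<close>

lemma integrated_expected_severity_eq:
  assumes int: "set_integrable lborel {x..} horizon_tail"
  shows "integrated_expected_severity M Y T x = (LINT y:{x..}|lborel. horizon_tail y)"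
proof -
  note [measurable] = Y_measurable_pair
  define e where "e t = (\<integral>\<^sup>+\<omega>. ennreal (max 0 (Y t \<omega> - x)) \<partial>M)" for t
  have [measurable]: "e \<in> borel_measurable borel"
  proof -
    have "(\<lambda>(t, \<omega>). ennreal (max 0 (Y t \<omega> - x))) = (\<lambda>u. ennreal (max 0 ((case u of (t, \<omega>) \<Rightarrow> Y t \<omega>) - x)))"
      by (auto simp: fun_eq_iff)
    also have "\<dots> \<in> borel_measurable (borel \<Otimes>\<^sub>M M)" by measurable
    finally show ?thesis unfolding e_def by (rule borel_measurable_nn_integral)
  qed
  have "(\<integral>\<^sup>+t. e t \<partial>\<Lambda>) = (\<integral>\<^sup>+u. ennreal (max 0 ((case u of (t, \<omega>) \<Rightarrow> Y t \<omega>) - x)) \<partial>(\<Lambda> \<Otimes>\<^sub>M M))"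
    using nn_integral_fst[of "\<lambda>u. ennreal (max 0 ((case u of (t, \<omega>) \<Rightarrow> Y t \<omega>) - x))" \<Lambda>] by (simp add: e_def)
  also have "\<dots> = (\<integral>\<^sup>+y\<in>{x..}. ennreal (horizon_tail y) \<partial>lborel)"
    unfolding emeasure_horizon[symmetric]
  proof (rule nn_integral_excess)
    interpret pair_sigma_finite \<Lambda> M ..
    show "sigma_finite_measure (\<Lambda> \<Otimes>\<^sub>M M)" by unfold_locales
  qed measurable
  also have "\<dots> = (\<integral>\<^sup>+y. ennreal (indicator {x..} y * horizon_tail y) \<partial>lborel)"
    by (intro nn_integral_cong) (auto simp: indicator_def)
  also have "\<dots> = ennreal (LINT y:{x..}|lborel. horizon_tail y)"
    using int horizon_tail_nonneg unfolding set_lebesgue_integral_def set_integrable_def real_scaleR_def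
    by (intro nn_integral_eq_integral) auto
  finally have e_int: "(\<integral>\<^sup>+t. e t \<partial>\<Lambda>) = ennreal (LINT y:{x..}|lborel. horizon_tail y)" .
  \<comment> \<open>Only where \<open>e t\<close> is finite does \<open>enn2real\<close> lose
    nothing.\<close>
  have "AE t in \<Lambda>. e t \<noteq> \<infinity>" by (rule nn_integral_PInf_AE) (auto simp: e_int)
  then have e_cong: "(\<integral>\<^sup>+t. ennreal (enn2real (e t)) \<partial>\<Lambda>) = (\<integral>\<^sup>+t. e t \<partial>\<Lambda>)"
    by (intro nn_integral_cong_AE) (auto simp: less_top elim!: eventually_mono)
  have "(\<integral>\<omega>. max 0 (Y t \<omega> - x) \<partial>M) = enn2real (e t)" for t
    unfolding e_def by (rule integral_eq_nn_integral) auto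
  then have "integrated_expected_severity M Y T x = (LINT t:{0..T}|lborel. enn2real (e t))"
    by (simp add: integrated_expected_severity_def)
  also have "\<dots> = (LINT t:{0<..T}|lborel. enn2real (e t))"
    unfolding set_lebesgue_integral_def
    by (rule integral_cong_AE; (measurable)?)
       (use AE_lborel_singleton[of 0] in eventually_elim, auto simp: indicator_def)
  also have "\<dots> = (\<integral>t. enn2real (e t) \<partial>\<Lambda>)" by (rule integral_\<Lambda>[symmetric]) measurable
  also have "\<dots> = enn2real (\<integral>\<^sup>+t. ennreal (enn2real (e t)) \<partial>\<Lambda>)"
    by (rule integral_eq_nn_integral) auto
  also have "\<dots> = (LINT y:{x..}|lborel. horizon_tail y)"
    unfolding e_cong e_int using horizon_tail_nonneg
    by (intro enn2real_ennreal) (auto simp: set_lebesgue_integral_def intro!: Bochner_Integration.integral_nonneg)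
  finally show ?thesis .
qed

section \<open>The shock tail, the limit constant and the conclusion\<close>

lemma F_pos: "0 < F y"
proof -
  have "\<forall>\<^sub>F x in at_top. 0 < F x \<and> y \<le> x"
    using X_tail eventually_ge_at_top[of y] by (auto simp: regularly_varying_def eventually_conj_iff)
  from eventually_happens'[OF trivial_limit_at_top_linorder this] obtain x where "0 < F x" "y \<le> x" by blast
  then show ?thesis using antimonoD[OF antimono_tail[of "X 1"], of y x] by (simp add: X_measurable)
qed

text \<open>A zero mean would make \<open>X 1\<close> vanish almost surely, against positivity of
  its tail. This secures \<gamma>, by which \<open>integrated_tail\<close> divides.\<close>

lemma X_mean_pos: "0 < (\<integral>\<omega>. X 1 \<omega> \<partial>M)"
proof -
  have "(\<integral>\<omega>. X 1 \<omega> \<partial>M) \<noteq> 0"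
  proof
    assume "(\<integral>\<omega>. X 1 \<omega> \<partial>M) = 0"
    then have "AE \<omega> in M. X 1 \<omega> = 0"
      using X_integrable X_nonneg[of 1] by (subst (asm) integral_nonneg_eq_0_iff_AE) auto
    then have "F 0 = 0"
      unfolding tail_def using X_measurable[of 1] by (intro prob_eq_0[THEN iffD2]) (auto elim!: eventually_mono)
    with F_pos[of 0] show False by simp
  qed
  moreover have "0 \<le> (\<integral>\<omega>. X 1 \<omega> \<partial>M)" using X_nonneg[of 1] by (intro integral_nonneg_AE) auto
  ultimately show ?thesis by simp
qed

lemma F_measurable[measurable]: "F \<in> borel_measurable borel"
  using X_tail by (simp add: regularly_varying_def)

lemma F_integrable: "set_integrable lborel {0..} F"
  unfolding set_integrable_def real_scaleR_def
proof (rule integrableI_nonneg)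
  have "(\<integral>\<^sup>+y. ennreal (indicator {0..} y * F y) \<partial>lborel) = (\<integral>\<^sup>+y\<in>{0..}. emeasure M {\<omega> \<in> space M. y < X 1 \<omega>} \<partial>lborel)"
    by (intro nn_integral_cong) (auto simp: indicator_def tail_def emeasure_eq_measure)
  also have "\<dots> = (\<integral>\<^sup>+\<omega>. ennreal (max 0 (X 1 \<omega> - 0)) \<partial>M)"
    by (rule nn_integral_excess[symmetric]) (auto intro: sigma_finite_measure_axioms)
  also have "\<dots> \<le> (\<integral>\<^sup>+\<omega>. ennreal (norm (X 1 \<omega>)) \<partial>M)"
    by (intro nn_integral_mono ennreal_leI) auto
  also have "\<dots> < \<infinity>" using X_integrable by (simp add: integrable_iff_bounded)
  finally show "(\<integral>\<^sup>+y. ennreal (indicator {0..} y * F y) \<partial>lborel) < \<infinity>" .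
qed (auto simp: tail_def)

lemma limit_constant_eq:
  "limit_constant = (LINT t:{0..T}|lborel. (\<integral>\<omega>. real (N t \<omega>) \<partial>M) * (\<integral>\<omega>. h 0 \<omega> t (V t \<omega>) powr \<alpha> \<partial>M))"
proof -
  have "enn2real (mark_moment \<alpha> t) = (\<integral>\<omega>. real (N t \<omega>) \<partial>M) * (\<integral>\<omega>. h 0 \<omega> t (V t \<omega>) powr \<alpha> \<partial>M)"
    if t: "0 < t" "t \<le> T" for t
  proof -
    have [measurable]: "(\<lambda>\<omega>. h 0 \<omega> t (V t \<omega>)) \<in> borel_measurable M"
      using measurable_Pair2[OF measurable_random_function[OF evaluation_measurable h_measurable, of "V t"], of t] V_density[OF t]
      by (simp add: distributed_def)
    have "(\<integral>\<omega>. real (N t \<omega>) \<partial>M) = enn2real (mean_count t)"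
      unfolding mean_count_def by (subst integral_eq_nn_integral) (auto simp: ennreal_of_nat_eq_real_of_nat)
    moreover have "(\<integral>\<omega>. h 0 \<omega> t (V t \<omega>) powr \<alpha> \<partial>M) = enn2real (\<integral>\<^sup>+\<omega>. ennreal (h 0 \<omega> t (V t \<omega>) powr \<alpha>) \<partial>M)"
      by (rule integral_eq_nn_integral) auto
    ultimately show ?thesis by (simp add: mark_moment_eq[OF t] enn2real_mult)
  qed
  \<comment> \<open>This closes the interval at 0: nothing is known about \<open>V 0\<close>, but
    its moment is multiplied by a zero mean count.\<close>
  moreover have "(\<integral>\<omega>. real (N 0 \<omega>) \<partial>M) = 0"
    using inhomogeneous_poisson_pointsD(3)[OF poisson] by (intro integral_eq_zero_AE) auto
  ultimately have "indicator {0<..T} t *\<^sub>R enn2real (mark_moment \<alpha> t) =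
      indicator {0..T} t *\<^sub>R ((\<integral>\<omega>. real (N t \<omega>) \<partial>M) * (\<integral>\<omega>. h 0 \<omega> t (V t \<omega>) powr \<alpha> \<partial>M))" for t
    by (cases "t = 0") (auto simp: indicator_def)
  then show ?thesis
    unfolding limit_constant_def by (subst integral_\<Lambda>) (auto simp: set_lebesgue_integral_def)
qed

lemma severity_asymp_equiv:
  "integrated_expected_severity M Y T \<sim>[at_top] (\<lambda>x. limit_constant * (LINT y:{x..}|lborel. F y))"
proof -
  note ratio = set_integral_ratio_limit[OF horizon_tail_measurable F_measurable F_pos F_integrable horizon_tail_limit]
  have eq: "\<forall>\<^sub>F x in at_top. integrated_expected_severity M Y T x = (LINT y:{x..}|lborel. horizon_tail y)"
    using ratio(1) by eventually_elim (rule integrated_expected_severity_eq)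
  show ?thesis
  proof (cases "limit_constant = 0")
    case True
    have "\<forall>\<^sub>F x in at_top. integrated_expected_severity M Y T x = 0"
      using eq eventually_ge_at_top[of 0]
    proof eventually_elim
      case (elim x)
      have "(LINT y:{x..}|lborel. horizon_tail y) = (LINT y:{x..}|lborel. 0)"
        using horizon_tail_zero[OF True] elim by (intro set_lebesgue_integral_cong) auto
      then show ?case using elim by simp
    qed
    then show ?thesis
      using True by (intro asymp_equivI tendsto_eventually) (auto elim!: eventually_mono)
  next
    case False
    have "((\<lambda>x. integrated_expected_severity M Y T x / (LINT y:{x..}|lborel. F y)) \<longlongrightarrow> limit_constant) at_top"
      using ratio(2) by (rule Lim_transform_eventually) (use eq in \<open>auto elim!: eventually_mono\<close>)
    then show ?thesis using False by (rule asymp_equivI'_const)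
  qed
qed

end

theorem proposition17:
  fixes M :: "'a measure"
    and X :: "nat \<Rightarrow> 'a \<Rightarrow> real"
    and S :: "(real \<Rightarrow> real \<Rightarrow> real) measure"
    and h :: "nat \<Rightarrow> 'a \<Rightarrow> real \<Rightarrow> real \<Rightarrow> real"
    and \<tau> :: "nat \<Rightarrow> 'a \<Rightarrow> real"
    and lam :: "real \<Rightarrow> real"
    and V :: "real \<Rightarrow> 'a \<Rightarrow> real"
    and T \<alpha> p \<gamma> :: real
  assumes "prob_space M"
    and "T > 0" and "\<alpha> > 0" and "p > \<alpha>"
    and poisson: "inhomogeneous_poisson_points M lam \<tau>"
    and shocks_nonneg: "\<forall>i\<ge>1. X i \<in> borel_measurable M \<and> (AE \<omega> in M. 0 \<le> X i \<omega>)"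
    and shock_functions: "iid_shock_functions M S h"
    and shocks_indep:
      "indep_elements M (\<Pi>\<^sub>M i\<in>{1..}. borel) (\<lambda>\<omega>. \<lambda>i\<in>{1..}. X i \<omega>)
         ((\<Pi>\<^sub>M i\<in>{1..}. S) \<Otimes>\<^sub>M (\<Pi>\<^sub>M i\<in>{1..}. borel))
         (\<lambda>\<omega>. (\<lambda>i\<in>{1..}. h i \<omega>, \<lambda>i\<in>{1..}. \<tau> i \<omega>))"
    and shock_functions_indep_points:
      "indep_elements M (\<Pi>\<^sub>M i\<in>{1..}. S) (\<lambda>\<omega>. \<lambda>i\<in>{1..}. h i \<omega>)
         (\<Pi>\<^sub>M i\<in>{1..}. borel) (\<lambda>\<omega>. \<lambda>i\<in>{1..}. \<tau> i \<omega>)"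
    and standing_moments:
      "\<forall>i\<ge>1. \<forall>t>0. \<exists>\<epsilon>>0. integrable M (\<lambda>\<omega>. h i \<omega> t (\<tau> i \<omega>) powr (\<alpha> + \<epsilon>))"
    and V_density:
      "\<forall>t\<in>{0<..T}. distributed M lborel (V t)
         (\<lambda>s. ennreal (lam s / cumulative_intensity lam t * indicator {0..t} s))"
    and V_indep: "\<forall>t\<in>{0<..T}. indep_elements M S (h 0) borel (V t)"
    and shocks_identically_distributed:
      "\<forall>i\<ge>1. distr M borel (X i) = distr M borel (X 1)"
    and shocks_mean: "\<forall>i\<ge>1. integrable M (X i) \<and> (\<integral>\<omega>. X i \<omega> \<partial>M) = \<gamma>"
    and shocks_tail: "regularly_varying (tail M (X 1)) (- \<alpha>)"
    and pairwise_tails: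
      "((\<lambda>x. SUP (i, j)\<in>{(i, j). 1 \<le> i \<and> 1 \<le> j \<and> i \<noteq> j}.
           measure M {\<omega> \<in> space M. X i \<omega> > x \<and> X j \<omega> > x} / measure M {\<omega> \<in> space M. X 1 \<omega> > x})
         \<longlongrightarrow> 0) at_top"
    and order_p_at_T: "integrable M (\<lambda>\<omega>. h 0 \<omega> T (V T \<omega>) powr p)"
    and order_p_on_horizon:
      "(\<integral>\<^sup>+t\<in>{0<..T}. (\<integral>\<^sup>+\<omega>. of_nat (num_points \<tau> t \<omega>) \<partial>M) *
          (\<integral>\<^sup>+\<omega>. ennreal (h 0 \<omega> t (V t \<omega>) powr p) \<partial>M) \<partial>lborel) < \<infinity>"
  shows "integrated_expected_severity M (shot_noise X h \<tau>) T \<sim>[at_top]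
    (\<lambda>x. \<gamma> * (LINT t:{0..T}|lborel. (\<integral>\<omega>. real (num_points \<tau> t \<omega>) \<partial>M) *
                (\<integral>\<omega>. h 0 \<omega> t (V t \<omega>) powr \<alpha> \<partial>M)) * integrated_tail M (X 1) \<gamma> x)"
proof -
  interpret prob_space M by fact
  have id: "tail M (X i) x = tail M (X 1) x" if "1 \<le> i" for i x
  proof -
    have eq: "tail M (X j) x = measure (distr M borel (X j)) {x<..}" if "1 \<le> j" for j
      using shocks_nonneg that by (subst measure_distr) (auto simp: tail_def intro!: arg_cong[where f=prob])
    have "distr M borel (X i) = distr M borel (X 1)"
      using shocks_identically_distributed that by blast
    then show ?thesis by (simp only: eq[OF that] eq[OF order_refl])
  qed
  have pair: "((\<lambda>x. prob {\<omega> \<in> space M. X i \<omega> > x \<and> X j \<omega> > x} / tail M (X 1) x) \<longlongrightarrow> 0) at_top"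
    if ij: "1 \<le> i" "1 \<le> j" "i \<noteq> j" for i j
  proof (rule real_tendsto_sandwich[OF _ _ tendsto_const pairwise_tails])
    let ?f = "\<lambda>x (i, j). prob {\<omega> \<in> space M. X i \<omega> > x \<and> X j \<omega> > x} / prob {\<omega> \<in> space M. X 1 \<omega> > x}"
    have "?f x (i, j) \<le> (SUP z\<in>{(i, j). 1 \<le> i \<and> 1 \<le> j \<and> i \<noteq> j}. ?f x z)" for x
    proof (rule cSUP_upper)
      \<comment> \<open>A real supremum dominates its members only for sets bounded above. The
        ratios are at most 1 because \<open>X i\<close> has the tail of \<open>X 1\<close>; if that
        tail is 0, the quotient is 0 by convention.\<close>
      show "bdd_above (?f x ` {(i, j). 1 \<le> i \<and> 1 \<le> j \<and> i \<noteq> j})"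
      proof (rule bdd_aboveI2)
        fix z assume "z \<in> {(i, j). (1 :: nat) \<le> i \<and> (1 :: nat) \<le> j \<and> i \<noteq> j}"
        then obtain i j where z: "z = (i, j)" "1 \<le> i" by auto
        have "prob {\<omega> \<in> space M. X i \<omega> > x \<and> X j \<omega> > x} \<le> prob {\<omega> \<in> space M. X i \<omega> > x}"
          using shocks_nonneg z(2) by (intro finite_measure_mono) auto
        also have "\<dots> = prob {\<omega> \<in> space M. X 1 \<omega> > x}" using id[OF z(2), of x] by (simp add: tail_def)
        finally show "?f x z \<le> 1" unfolding z(1) by (auto simp: divide_le_eq_1 zero_less_measure_iff)
      qed
    qed (use ij in auto)
    then show "\<forall>\<^sub>F x in at_top. prob {\<omega> \<in> space M. X i \<omega> > x \<and> X j \<omega> > x} / tail M (X 1) x \<le>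
        (SUP (i, j)\<in>{(i, j). 1 \<le> i \<and> 1 \<le> j \<and> i \<noteq> j}. prob {\<omega> \<in> space M. X i \<omega> > x \<and> X j \<omega> > x} / prob {\<omega> \<in> space M. X 1 \<omega> > x})"
      by (simp add: tail_def)
  qed (auto simp: tail_def)
  interpret shot_noise_model M X S h \<tau> lam \<alpha> p
  proof unfold_locales
    show "X i \<in> borel_measurable M" "AE \<omega> in M. 0 \<le> X i \<omega>" if "1 \<le> i" for i
      using shocks_nonneg that by auto
  qed (fact | rule id pair, assumption+)+
  interpret shot_noise_horizon M X S h \<tau> lam \<alpha> p T V
  proof unfold_locales
    show "integrable M (X 1)" using shocks_mean by simp
    show "(\<integral>\<^sup>+t\<in>{0<..T}. mean_count t * (\<integral>\<^sup>+\<omega>. ennreal (h 0 \<omega> t (V t \<omega>) powr p) \<partial>M) \<partial>lborel) < \<infinity>"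
      using order_p_on_horizon by (simp add: mean_count_def)
  qed (use V_density V_indep in \<open>simp_all only: greaterThanAtMost_iff Ball_def\<close>)
  \<comment> \<open>The factor \<gamma> in front cancels against \<open>1 / \<gamma>\<close> in the
    integrated tail.\<close>
  have "\<gamma> \<noteq> 0" using X_mean_pos shocks_mean by auto
  then have "(\<lambda>x. \<gamma> * limit_constant * integrated_tail M (X 1) \<gamma> x) = (\<lambda>x. limit_constant * (LINT y:{x..}|lborel. F y))"
    by (simp add: integrated_tail_def)
  then show ?thesis using severity_asymp_equiv by (simp only: limit_constant_eq)
qed

end
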